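(* Let $G$ be any group and let $F$ be an algebraically closed field of characteristic zero. Let $A$ and $B$ be two finite dimensional simple $G$-graded (associative) algebras over $F$. Then $A$ and $B$ are isomorphic as $G$-graded algebras if and only if $\mathrm{Id}_{G}(A)=\mathrm{Id}_{G}(B)$.
   Context: All algebras are associative. An $F$-algebra $A$ is $G$-graded if it is given with a decomposition $A=\bigoplus_{g\in G}A_g$ into $F$-subspaces (possibly zero) such that $A_gA_h\subseteq A_{gh}$ for all $g,h\in G$. A $G$-graded isomorphism is an $F$-algebra isomorphism mapping the $g$-component onto the $g$-component for every $g\in G$. A $G$-graded algebra is a simple $G$-graded algebra (or $G$-simple) if it has no nontrivial homogeneous two-sided ideals, equivalently if the ideal generated by each nonzero homogeneous element is the whole algebra. Let $X_G=\bigcup_{g\in G}X_g$ with $X_g=\{x_{1,g},x_{2,g},\dots\}$ countably many variables of degree $g$, and let $F\langle X_G\rangle$ be the free associative algebra on $X_G$. A polynomial $p\in F\langle X_G\rangle$ is a $G$-graded identity of a $G$-graded algebra $A$ if $p$ vanishes under every graded evaluation on $A$, i.e. every substitution replacing each variable of degree $g$ by an element of $A_g$, for all $g\in G$. $\mathrm{Id}_G(A)\subseteq F\langle X_G\rangle$ denotes the set (ideal) of all $G$-graded identities of $A$. *)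

theory Defs
  imports "HOL-Computational_Algebra.Polynomial" "HOL-Library.Poly_Mapping"
begin

(* Associative algebras over a field: the multiplication is that of the class ring
   (associative, neither unital nor commutative). *)

locale assoc_algebra = vector_space scale
  for scale :: "'f::field \<Rightarrow> 'a::ring \<Rightarrow> 'a" (infixr \<open>*s\<close> 75) +
  assumes scale_mult_left: "(c *s x) * y = c *s (x * y)"
    and scale_mult_right: "x * (c *s y) = c *s (x * y)"

(* c is the family of components of x in a decomposition along the family V. *)

definition homogeneous_decomposition :: "('g \<Rightarrow> 'a::comm_monoid_add set) \<Rightarrow> 'a \<Rightarrow> ('g \<Rightarrow> 'a) \<Rightarrow> bool"
  where "homogeneous_decomposition V x c \<longleftrightarrow>
    (\<forall>g. c g \<in> V g) \<and> finite {g. c g \<noteq> 0} \<and> x = (\<Sum>g | c g \<noteq> 0. c g)"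

(* The grading group is written additively because group_add is the library's class of groups;
   it is not assumed commutative, and g + h stands for the product gh. *)

locale graded_algebra = assoc_algebra scale
  for scale :: "'f::field \<Rightarrow> 'a::ring \<Rightarrow> 'a" (infixr \<open>*s\<close> 75) +
  fixes comp :: "'g::group_add \<Rightarrow> 'a set"
  assumes subspace_comp: "subspace (comp g)"
    and direct_sum: "\<exists>!c. homogeneous_decomposition comp x c"
    and mult_comp: "x \<in> comp g \<Longrightarrow> y \<in> comp h \<Longrightarrow> x * y \<in> comp (g + h)"
begin

definition two_sided_ideal :: "'a set \<Rightarrow> bool"
  where "two_sided_ideal I \<longleftrightarrow> subspace I \<and> (\<forall>x\<in>I. \<forall>a. a * x \<in> I \<and> x * a \<in> I)"

definition homogeneous :: "'a set \<Rightarrow> bool"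
  where "homogeneous I \<longleftrightarrow> (\<forall>x\<in>I. \<exists>c. homogeneous_decomposition (\<lambda>g. I \<inter> comp g) x c)"

end

locale simple_graded_algebra = graded_algebra +
  assumes simple: "two_sided_ideal I \<Longrightarrow> homogeneous I \<Longrightarrow> I = {0} \<or> I = UNIV"

definition graded_isomorphism ::
  "('f::field \<Rightarrow> 'a::ring \<Rightarrow> 'a) \<Rightarrow> ('g \<Rightarrow> 'a set) \<Rightarrow>
   ('f \<Rightarrow> 'b::ring \<Rightarrow> 'b) \<Rightarrow> ('g \<Rightarrow> 'b set) \<Rightarrow> ('a \<Rightarrow> 'b) \<Rightarrow> bool"
  where "graded_isomorphism sA A sB B f \<longleftrightarrow>
    Vector_Spaces.linear sA sB f \<and> (\<forall>x y. f (x * y) = f x * f y) \<and> bij f \<and> (\<forall>g. f ` A g = B g)"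

definition graded_isomorphic ::
  "('f::field \<Rightarrow> 'a::ring \<Rightarrow> 'a) \<Rightarrow> ('g \<Rightarrow> 'a set) \<Rightarrow>
   ('f \<Rightarrow> 'b::ring \<Rightarrow> 'b) \<Rightarrow> ('g \<Rightarrow> 'b set) \<Rightarrow> bool"
  where "graded_isomorphic sA A sB B \<longleftrightarrow> (\<exists>f. graded_isomorphism sA A sB B f)"

(* The pair (i, g) is the variable x_{i,g}. Words form the free monoid on these variables,
   written additively so that the convolution product of Poly_Mapping turns
   'g word =>0 'f into the free associative algebra with unit. *)

datatype 'g word = Word (letters: "(nat \<times> 'g) list")

instantiation word :: (type) monoid_add
begin

definition zero_word :: "'a word"
  where "0 = Word []"

definition plus_word :: "'a word \<Rightarrow> 'a word \<Rightarrow> 'a word"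
  where "v + w = Word (letters v @ letters w)"

instance
  by standard (simp_all add: zero_word_def plus_word_def)

end

type_synonym ('g, 'f) graded_poly = "'g word \<Rightarrow>\<^sub>0 'f"

definition graded_assignment :: "('g \<Rightarrow> 'a set) \<Rightarrow> (nat \<times> 'g \<Rightarrow> 'a) \<Rightarrow> bool"
  where "graded_assignment A \<phi> \<longleftrightarrow> (\<forall>i g. \<phi> (i, g) \<in> A g)"

(* The algebra need not have a unit, so the empty product has no meaning in it; the first
   equation is a dummy, never reached for polynomials without constant term. *)

fun word_value :: "(nat \<times> 'g \<Rightarrow> 'a::ring) \<Rightarrow> (nat \<times> 'g) list \<Rightarrow> 'a"
  where
    "word_value \<phi> [] = 0"
  | "word_value \<phi> [x] = \<phi> x"
  | "word_value \<phi> (x # y # w) = \<phi> x * word_value \<phi> (y # w)"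

definition poly_value ::
  "('f::field \<Rightarrow> 'a::ring \<Rightarrow> 'a) \<Rightarrow> (nat \<times> 'g \<Rightarrow> 'a) \<Rightarrow> ('g, 'f) graded_poly \<Rightarrow> 'a"
  where "poly_value s \<phi> p =
    (\<Sum>w\<in>Poly_Mapping.keys p. s (Poly_Mapping.lookup p w) (word_value \<phi> (letters w)))"

(* Id_G(A). Identities have zero constant term, as usual for algebras not assumed to be unital.
   For a nonzero unital algebra this is automatic: substitute 0 for all variables. *)

definition graded_identities ::
  "('f::field \<Rightarrow> 'a::ring \<Rightarrow> 'a) \<Rightarrow> ('g \<Rightarrow> 'a set) \<Rightarrow> ('g, 'f) graded_poly set"
  where "graded_identities s A =
    {p. Poly_Mapping.lookup p 0 = 0 \<and> (\<forall>\<phi>. graded_assignment A \<phi> \<longrightarrow> poly_value s \<phi> p = 0)}"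

end

theory Submission
  imports Defs "HOL-Combinatorics.Permutations"
begin

text \<open>
  If \<open>AA = 0\<close>, graded simplicity leaves only \<open>A = 0\<close> or \<open>A\<close> one-dimensional in a single degree. Otherwise the
  argument follows Razmyslov and avoids the classification of graded simple algebras.

  Let \<open>A\<close> have a homogeneous basis of size \<open>n\<close>. By the density theorem (the graded centroid consists of
  scalars) a graded Capelli polynomial \<open>f\<close>, alternating in \<open>n\<close> variables of the degrees of the basis, is not an
  identity of \<open>A\<close>, hence not of \<open>B\<close>; so the dimensions agree and \<open>B\<close> has a basis of the same degrees. For an operator
  \<open>T\<close> preserving the component of degree \<open>g\<close>, replacing \<open>x\<close> by \<open>T x\<close> in turn for each alternating variable of degree
  \<open>g\<close> multiplies \<open>f\<close> by the trace of \<open>T\<close> on that component. With \<open>T x = w x w'\<close> for monomials \<open>w, w'\<close>, every trace polynomial times \<open>f\<close>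
  is therefore an ordinary graded polynomial, and \<open>A\<close> and \<open>B\<close> satisfy the same trace identities.

  Thus a point \<open>z'\<close> of \<open>B\<close> defines a homomorphism from the trace ring of generic elements of \<open>A\<close> to \<open>F\<close>. If \<open>z'\<close> is
  chosen outside the zero set of a suitable trace polynomial, this homomorphism extends to the
  ring of polynomial functions on the coordinates (this uses that \<open>F\<close> is algebraically closed), i.e. there is a basis
  \<open>z\<close> of \<open>A\<close> with the same traces as \<open>z'\<close>. Again by density these traces determine the structure constants, so
  \<open>z\<close> \<open>\<mapsto>\<close> \<open>z'\<close> is an isomorphism.
\<close>

section \<open>Evaluation of graded polynomials\<close>

text \<open>The value on the empty list is junk, as for \<open>word_value\<close>.\<close>

fun wprod :: "'a::ring list \<Rightarrow> 'a" where
  "wprod [] = 0"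
| "wprod [x] = x"
| "wprod (x # y # w) = x * wprod (y # w)"

lemma wprod_Cons: "wprod (x # w) = (if w = [] then x else x * wprod w)"
  by (cases w) auto

lemma wprod_append: "v \<noteq> [] \<Longrightarrow> w \<noteq> [] \<Longrightarrow> wprod (v @ w) = wprod v * wprod w"
  by (induction v) (auto simp: wprod_Cons mult.assoc)

lemma word_value_eq_wprod: "word_value \<phi> w = wprod (map \<phi> w)"
  by (induction \<phi> w rule: word_value.induct) auto

definition pscale :: "'f::field \<Rightarrow> ('g, 'f) graded_poly \<Rightarrow> ('g, 'f) graded_poly" where
  "pscale c p = Poly_Mapping.map ((*) c) p"

definition pvar :: "nat \<times> 'g \<Rightarrow> ('g, 'f::field) graded_poly" where
  "pvar x = Poly_Mapping.single (Word [x]) 1"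

definition psubst :: "(nat \<times> 'g \<Rightarrow> ('g, 'f) graded_poly) \<Rightarrow> ('g, 'f::field) graded_poly \<Rightarrow> ('g, 'f) graded_poly" where
  "psubst \<theta> p = poly_value pscale \<theta> p"

abbreviation const_free :: "('g, 'f::field) graded_poly \<Rightarrow> bool" where
  "const_free p \<equiv> Poly_Mapping.lookup p 0 = 0"

lemma lookup_pscale [simp]: "Poly_Mapping.lookup (pscale c p) w = c * Poly_Mapping.lookup p w"
  by (auto simp: pscale_def Poly_Mapping.map.rep_eq when_def)

lemma letters_zero [simp]: "letters 0 = []"
  by (simp add: zero_word_def)

lemma letters_eq_Nil_iff: "letters w = [] \<longleftrightarrow> w = 0"
  by (cases w) (simp add: zero_word_def)

lemma letters_plus [simp]: "letters (v + w) = letters v @ letters w"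
  by (simp add: plus_word_def)

lemma plus_word_eq_0_iff: "v + w = (0 :: 'g word) \<longleftrightarrow> v = 0 \<and> w = 0"
  by (metis letters_eq_Nil_iff letters_plus append_is_Nil_conv)

lemma poly_eq_sum_single: "p = (\<Sum>w\<in>Poly_Mapping.keys p. Poly_Mapping.single w (Poly_Mapping.lookup p w))"
  by (rule poly_mapping_eqI) (simp add: lookup_sum lookup_single when_def in_keys_iff)

lemma mult_eq_sum_single:
  fixes p q :: "('g, 'f::field) graded_poly"
  shows "p * q = (\<Sum>v\<in>Poly_Mapping.keys p. \<Sum>w\<in>Poly_Mapping.keys q.
    Poly_Mapping.single (v + w) (Poly_Mapping.lookup p v * Poly_Mapping.lookup q w))"
  by (subst poly_eq_sum_single[of p], subst poly_eq_sum_single[of q])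
     (simp add: sum_product mult_single)

lemma const_free_pvar [simp]: "const_free (pvar x)"
  by (simp add: pvar_def lookup_single when_def zero_word_def)

lemma const_free_mult:
  fixes p q :: "('g, 'f::field) graded_poly"
  assumes "const_free p" shows "const_free (p * q)"
  unfolding mult_eq_sum_single lookup_sum
  by (intro sum.neutral ballI) (use assms in \<open>auto simp: lookup_single when_def plus_word_eq_0_iff\<close>)

lemma const_free_sum: "(\<And>i. i \<in> I \<Longrightarrow> const_free (p i)) \<Longrightarrow> const_free (\<Sum>i\<in>I. p i)"
  by (simp add: lookup_sum)

lemma const_free_wprod:
  fixes ps :: "('g, 'f::field) graded_poly list"
  shows "(\<And>p. p \<in> set ps \<Longrightarrow> const_free p) \<Longrightarrow> const_free (wprod ps)"
  by (induction ps rule: wprod.induct) (auto intro: const_free_mult)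

lemma const_free_psubst:
  assumes "\<And>x. const_free (\<theta> x)" shows "const_free (psubst \<theta> p)"
proof -
  have "const_free (wprod (map \<theta> l))" for l
    by (rule const_free_wprod) (use assms in auto)
  then show ?thesis
    unfolding psubst_def poly_value_def word_value_eq_wprod
    by (intro const_free_sum) simp
qed

context assoc_algebra
begin

abbreviation pval :: "(nat \<times> 'g \<Rightarrow> 'a) \<Rightarrow> ('g, 'f) graded_poly \<Rightarrow> 'a" where
  "pval \<equiv> poly_value (*s)"

lemma pval_superset:
  assumes "finite S" "Poly_Mapping.keys p \<subseteq> S"
  shows "pval \<phi> p = (\<Sum>w\<in>S. Poly_Mapping.lookup p w *s wprod (map \<phi> (letters w)))"
  unfolding poly_value_def word_value_eq_wprod using assms
  by (intro sum.mono_neutral_left) (auto simp: in_keys_iff)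

lemma pval_zero [simp]: "pval \<phi> 0 = 0"
  by (simp add: poly_value_def)

lemma pval_add: "pval \<phi> (p + q) = pval \<phi> p + pval \<phi> q"
proof -
  let ?S = "Poly_Mapping.keys p \<union> Poly_Mapping.keys q"
  have "Poly_Mapping.keys (p + q) \<subseteq> ?S" by (rule Poly_Mapping.keys_add)
  then show ?thesis
    by (simp add: pval_superset[of ?S] lookup_add scale_left_distrib sum.distrib)
qed

lemma pval_sum: "pval \<phi> (\<Sum>i\<in>I. p i) = (\<Sum>i\<in>I. pval \<phi> (p i))"
  by (induction I rule: infinite_finite_induct) (simp_all add: pval_add)

lemma pval_pscale: "pval \<phi> (pscale c p) = c *s pval \<phi> p"
proof -
  have "Poly_Mapping.keys (pscale c p) \<subseteq> Poly_Mapping.keys p"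
    by (auto simp: in_keys_iff)
  then show ?thesis
    by (simp add: pval_superset[of "Poly_Mapping.keys p"] scale_sum_right)
qed

lemma pval_single: "pval \<phi> (Poly_Mapping.single w c) = c *s wprod (map \<phi> (letters w))"
  by (subst pval_superset[of "{w}"]) (auto simp: lookup_single)

lemma pval_pvar [simp]: "pval \<phi> (pvar x) = \<phi> x"
  by (simp add: pvar_def pval_single)

text \<open>The empty word evaluates to 0 and not to a unit, so concatenation of words corresponds
  to multiplication of values only for nonempty words; zero constant terms guarantee that.\<close>

lemma pval_mult:
  assumes "const_free p" "const_free q"
  shows "pval \<phi> (p * q) = pval \<phi> p * pval \<phi> q"
proof -
  have "pval \<phi> (p * q) = (\<Sum>v\<in>Poly_Mapping.keys p. \<Sum>w\<in>Poly_Mapping.keys q.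
      (Poly_Mapping.lookup p v * Poly_Mapping.lookup q w) *s wprod (map \<phi> (letters v @ letters w)))"
    by (subst mult_eq_sum_single) (simp add: pval_sum pval_single)
  also have "\<dots> = (\<Sum>v\<in>Poly_Mapping.keys p. \<Sum>w\<in>Poly_Mapping.keys q.
      (Poly_Mapping.lookup p v *s wprod (map \<phi> (letters v))) *
      (Poly_Mapping.lookup q w *s wprod (map \<phi> (letters w))))"
  proof (intro sum.cong refl)
    fix v w assume "v \<in> Poly_Mapping.keys p" "w \<in> Poly_Mapping.keys q"
    then have "letters v \<noteq> []" "letters w \<noteq> []"
      using assms by (auto simp: in_keys_iff letters_eq_Nil_iff)
    then show "(Poly_Mapping.lookup p v * Poly_Mapping.lookup q w) *s wprod (map \<phi> (letters v @ letters w))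
      = (Poly_Mapping.lookup p v *s wprod (map \<phi> (letters v))) *
      (Poly_Mapping.lookup q w *s wprod (map \<phi> (letters w)))"
      by (simp add: wprod_append scale_mult_left scale_mult_right mult.commute)
  qed
  finally show ?thesis
    by (simp add: sum_product poly_value_def word_value_eq_wprod)
qed

lemma pval_wprod:
  "(\<And>p. p \<in> set ps \<Longrightarrow> const_free p) \<Longrightarrow> pval \<phi> (wprod ps) = wprod (map (pval \<phi>) ps)"
proof (induction ps rule: wprod.induct)
  case (3 p q ps)
  then have "const_free (wprod (q # ps))" "const_free p"
    by (auto intro: const_free_wprod)
  with 3 show ?case
    by (simp add: pval_mult)
qed auto

lemma pval_psubst:
  assumes "\<And>x. const_free (\<theta> x)"
  shows "pval \<phi> (psubst \<theta> p) = pval (\<lambda>x. pval \<phi> (\<theta> x)) p"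
proof -
  have "pval \<phi> (psubst \<theta> p) = (\<Sum>w\<in>Poly_Mapping.keys p.
      Poly_Mapping.lookup p w *s pval \<phi> (wprod (map \<theta> (letters w))))"
    unfolding psubst_def
    by (subst poly_value_def) (simp add: pval_sum pval_pscale word_value_eq_wprod)
  also have "\<dots> = pval (\<lambda>x. pval \<phi> (\<theta> x)) p"
    unfolding poly_value_def[of _ _ p] word_value_eq_wprod
    by (intro sum.cong refl arg_cong2[where f = "(*s)"], subst pval_wprod) (auto simp: assms o_def)
  finally show ?thesis .
qed

end

section \<open>Specialization of polynomial functions\<close>

definition is_subring :: "'d::comm_ring_1 set \<Rightarrow> bool" where
  "is_subring R \<longleftrightarrow> 1 \<in> R \<and> (\<forall>x\<in>R. \<forall>y\<in>R. x + y \<in> R \<and> x * y \<in> R) \<and> (\<forall>x\<in>R. - x \<in> R)"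

definition hom_on :: "'d::comm_ring_1 set \<Rightarrow> ('d \<Rightarrow> 'f::field) \<Rightarrow> bool" where
  "hom_on R \<phi> \<longleftrightarrow> \<phi> 1 = 1 \<and> (\<forall>x\<in>R. \<forall>y\<in>R. \<phi> (x + y) = \<phi> x + \<phi> y \<and> \<phi> (x * y) = \<phi> x * \<phi> y)"

definition polys_over :: "'d::comm_ring_1 set \<Rightarrow> 'd poly set" where
  "polys_over R = {p. \<forall>i. coeff p i \<in> R}"

definition adjoin :: "'d::comm_ring_1 set \<Rightarrow> 'd \<Rightarrow> 'd set" where
  "adjoin R x = (\<lambda>p. poly p x) ` polys_over R"

context
  fixes R :: "'d::idom set"
  assumes R: "is_subring R"
begin

lemma subring_0: "0 \<in> R"
  using R unfolding is_subring_def by (metis add.right_inverse)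

lemma subring_closed:
  "1 \<in> R" "x \<in> R \<Longrightarrow> y \<in> R \<Longrightarrow> x + y \<in> R" "x \<in> R \<Longrightarrow> y \<in> R \<Longrightarrow> x * y \<in> R"
  "x \<in> R \<Longrightarrow> - x \<in> R" "x \<in> R \<Longrightarrow> y \<in> R \<Longrightarrow> x - y \<in> R"
  using R unfolding is_subring_def by (auto simp: diff_conv_add_uminus simp del: add_uminus_conv_diff)

lemma subring_sum: "(\<And>i. i \<in> I \<Longrightarrow> f i \<in> R) \<Longrightarrow> (\<Sum>i\<in>I. f i) \<in> R"
  by (induction I rule: infinite_finite_induct) (auto simp: subring_0 subring_closed)

lemma subring_power: "x \<in> R \<Longrightarrow> x ^ n \<in> R"
  by (induction n) (auto simp: subring_closed)

lemma polys_over_closed: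
  "0 \<in> polys_over R" "c \<in> R \<Longrightarrow> [:c:] \<in> polys_over R" "[:0, 1:] \<in> polys_over R"
  "p \<in> polys_over R \<Longrightarrow> q \<in> polys_over R \<Longrightarrow> p + q \<in> polys_over R"
  "p \<in> polys_over R \<Longrightarrow> q \<in> polys_over R \<Longrightarrow> p - q \<in> polys_over R"
  "p \<in> polys_over R \<Longrightarrow> - p \<in> polys_over R"
  "p \<in> polys_over R \<Longrightarrow> q \<in> polys_over R \<Longrightarrow> p * q \<in> polys_over R"
  "c \<in> R \<Longrightarrow> p \<in> polys_over R \<Longrightarrow> smult c p \<in> polys_over R"
  "c \<in> R \<Longrightarrow> monom c n \<in> polys_over R"
  unfolding polys_over_def
  by (auto simp: subring_0 subring_closed coeff_mult coeff_pCons split: nat.split intro!: subring_sum)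

lemma coeff_polys_over: "p \<in> polys_over R \<Longrightarrow> coeff p i \<in> R"
  by (simp add: polys_over_def)

lemma is_subring_adjoin: "is_subring (adjoin R x)"
proof -
  have "1 = poly [:1:] x" by simp
  then have "1 \<in> adjoin R x"
    unfolding adjoin_def using polys_over_closed(2)[OF subring_closed(1)] by blast
  moreover have "poly p x + poly q x \<in> adjoin R x" "poly p x * poly q x \<in> adjoin R x" "- poly p x \<in> adjoin R x"
    if "p \<in> polys_over R" "q \<in> polys_over R" for p q
    unfolding adjoin_def poly_add[symmetric] poly_mult[symmetric] poly_minus[symmetric]
    using that by (blast intro: polys_over_closed)+
  ultimately show ?thesis
    unfolding is_subring_def adjoin_def by blast
qed

lemma subset_adjoin: "R \<subseteq> adjoin R x"
proof
  fix c assume "c \<in> R"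
  moreover have "c = poly [:c:] x" by simp
  ultimately show "c \<in> adjoin R x"
    unfolding adjoin_def using polys_over_closed(2) by blast
qed

lemma mem_adjoin: "x \<in> adjoin R x"
proof -
  have "x = poly [:0, 1:] x" by simp
  then show ?thesis
    unfolding adjoin_def using polys_over_closed(3) by blast
qed

text \<open>Long division without inverses: multiplying the dividend by \<open>lead_coeff g\<close>
  before each cancellation of a leading term keeps all coefficients in \<open>R\<close>.\<close>

lemma pseudo_division_over:
  assumes g: "g \<in> polys_over R" "g \<noteq> 0" and f: "f \<in> polys_over R"
  shows "\<exists>k. \<exists>q\<in>polys_over R. \<exists>r\<in>polys_over R.
    smult (lead_coeff g ^ k) f = g * q + r \<and> (r = 0 \<or> degree r < degree g)"
proof -
  have "f \<in> polys_over R \<Longrightarrow> f = 0 \<or> degree f < N \<Longrightarrow> ?thesis" for N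
    using f
  proof (induction N arbitrary: f)
    case 0
    then show ?case
      by (intro exI[of _ 0] bexI[of _ 0]) (auto simp: polys_over_closed)
  next
    case (Suc N)
    show ?case
    proof (cases "f = 0 \<or> degree f < degree g")
      case True
      with Suc.prems show ?thesis
        by (intro exI[of _ 0] bexI[of _ 0] bexI[of _ f]) (auto simp: polys_over_closed)
    next
      case False
      let ?h = "monom (lead_coeff f) (degree f - degree g)"
      define f' where "f' = smult (lead_coeff g) f - g * ?h"
      have h: "?h \<in> polys_over R"
        using Suc.prems coeff_polys_over polys_over_closed(9) by blast
      have f': "f' \<in> polys_over R"
        unfolding f'_def using Suc.prems g h by (intro polys_over_closed coeff_polys_over) auto
      have "degree (g * ?h) \<le> degree f"
        using degree_mult_le[of g ?h] degree_monom_le[of "lead_coeff f" "degree f - degree g"] False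
        by linarith
      then have "degree f' \<le> degree f"
        unfolding f'_def by (intro degree_diff_le) auto
      moreover have "coeff (g * ?h) (degree f) = lead_coeff g * lead_coeff f"
        using False coeff_mult_degree_sum[of g ?h] by (simp add: degree_monom_eq)
      then have "coeff f' (degree f) = 0"
        by (simp add: f'_def)
      ultimately have "f' = 0 \<or> degree f' < N"
        using eq_zero_or_degree_less[of f' "degree f"] Suc.prems False by fastforce
      from Suc.IH[OF f' this f'] obtain k q r where
        *: "q \<in> polys_over R" "r \<in> polys_over R" "smult (lead_coeff g ^ k) f' = g * q + r"
          "r = 0 \<or> degree r < degree g"
        by blast
      have "smult (lead_coeff g ^ Suc k) f = smult (lead_coeff g ^ k) f' + smult (lead_coeff g ^ k) (g * ?h)"
        by (simp add: f'_def smult_diff_right mult.commute)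
      also have "\<dots> = g * (q + smult (lead_coeff g ^ k) ?h) + r"
        by (simp add: *(3) algebra_simps)
      finally show ?thesis
        using * h g by (intro exI[of _ "Suc k"] bexI[of _ "q + smult (lead_coeff g ^ k) ?h"] bexI[of _ r])
          (auto intro!: polys_over_closed subring_power coeff_polys_over)
    qed
  qed
  from this[of "Suc (degree f)"] f show ?thesis by simp
qed

context
  fixes \<phi> :: "'d \<Rightarrow> 'f::field"
  assumes \<phi>: "hom_on R \<phi>"
begin

lemma hom_on_simps:
  "\<phi> 1 = 1" "x \<in> R \<Longrightarrow> y \<in> R \<Longrightarrow> \<phi> (x + y) = \<phi> x + \<phi> y"
  "x \<in> R \<Longrightarrow> y \<in> R \<Longrightarrow> \<phi> (x * y) = \<phi> x * \<phi> y"
  using \<phi> unfolding hom_on_def by auto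

lemma hom_on_0 [simp]: "\<phi> 0 = 0"
  using hom_on_simps(2)[OF subring_0 subring_0] by (metis add_0 add_left_imp_eq add.right_neutral)

lemma hom_on_sum: "(\<And>i. i \<in> I \<Longrightarrow> f i \<in> R) \<Longrightarrow> \<phi> (\<Sum>i\<in>I. f i) = (\<Sum>i\<in>I. \<phi> (f i))"
  by (induction I rule: infinite_finite_induct) (auto simp: hom_on_simps subring_sum)

lemma hom_on_power: "x \<in> R \<Longrightarrow> \<phi> (x ^ n) = \<phi> x ^ n"
  by (induction n) (auto simp: hom_on_simps subring_power)

lemma map_poly_hom_add:
  "p \<in> polys_over R \<Longrightarrow> q \<in> polys_over R \<Longrightarrow> map_poly \<phi> (p + q) = map_poly \<phi> p + map_poly \<phi> q"
  by (rule poly_eqI) (simp add: coeff_map_poly hom_on_simps coeff_polys_over)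

lemma map_poly_hom_mult:
  "p \<in> polys_over R \<Longrightarrow> q \<in> polys_over R \<Longrightarrow> map_poly \<phi> (p * q) = map_poly \<phi> p * map_poly \<phi> q"
  by (rule poly_eqI) (simp add: coeff_map_poly coeff_mult hom_on_simps hom_on_sum coeff_polys_over subring_closed)

lemma map_poly_hom_smult:
  "c \<in> R \<Longrightarrow> p \<in> polys_over R \<Longrightarrow> map_poly \<phi> (smult c p) = smult (\<phi> c) (map_poly \<phi> p)"
  by (rule poly_eqI) (simp add: coeff_map_poly hom_on_simps coeff_polys_over)

text \<open>An extension with \<open>x\<close> going to \<open>\<xi>\<close> must send
  \<open>poly p x\<close> to the value at \<open>\<xi>\<close> of the specialized polynomial;
  \<open>wd\<close> says that this does not depend on the choice of \<open>p\<close>.\<close>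

lemma extend_hom_to_adjoin:
  assumes wd: "\<And>p. p \<in> polys_over R \<Longrightarrow> poly p x = 0 \<Longrightarrow> poly (map_poly \<phi> p) \<xi> = 0"
  obtains \<phi>' where "hom_on (adjoin R x) \<phi>'" "\<And>c. c \<in> R \<Longrightarrow> \<phi>' c = \<phi> c"
    "\<And>p. p \<in> polys_over R \<Longrightarrow> \<phi>' (poly p x) = poly (map_poly \<phi> p) \<xi>"
proof -
  define \<phi>' where "\<phi>' y = poly (map_poly \<phi> (SOME p. p \<in> polys_over R \<and> poly p x = y)) \<xi>" for y
  have eq: "\<phi>' (poly p x) = poly (map_poly \<phi> p) \<xi>" if p: "p \<in> polys_over R" for p
  proof -
    define q where "q = (SOME q. q \<in> polys_over R \<and> poly q x = poly p x)"
    have q: "q \<in> polys_over R" "poly q x = poly p x"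
      using someI[of "\<lambda>q. q \<in> polys_over R \<and> poly q x = poly p x" p] p by (auto simp: q_def)
    have "poly (map_poly \<phi> (p - q)) \<xi> = 0"
      using p q by (intro wd) (auto intro: polys_over_closed)
    moreover have "map_poly \<phi> p = map_poly \<phi> (p - q) + map_poly \<phi> q"
      using map_poly_hom_add[of "p - q" q] p q by (simp add: polys_over_closed)
    ultimately show ?thesis
      by (simp add: \<phi>'_def flip: q_def)
  qed
  show ?thesis
  proof
    show "\<phi>' c = \<phi> c" if "c \<in> R" for c
      using eq[of "[:c:]"] that by (simp add: polys_over_closed map_poly_pCons)
    then have "\<phi>' 1 = 1"
      by (simp add: subring_closed hom_on_simps)
    moreover have "\<phi>' (poly p x + poly q x) = \<phi>' (poly p x) + \<phi>' (poly q x)"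
      "\<phi>' (poly p x * poly q x) = \<phi>' (poly p x) * \<phi>' (poly q x)"
      if "p \<in> polys_over R" "q \<in> polys_over R" for p q
      using eq[of "p + q"] eq[of "p * q"] that
      by (simp_all add: eq polys_over_closed map_poly_hom_add map_poly_hom_mult)
    ultimately show "hom_on (adjoin R x) \<phi>'"
      by (auto simp: hom_on_def adjoin_def)
  qed (fact eq)
qed

end

text \<open>With \<open>v = poly q x\<close>, the condition on the leading coefficient of
  \<open>q\<close> keeps the specialized \<open>q\<close> nonzero, and in an infinite field some
  \<open>\<xi>\<close> avoids its finitely many roots. Any such \<open>\<xi>\<close> may be the
  image of \<open>x\<close>, which satisfies no equation.\<close>

lemma extend_hom_transcendental:
  assumes tr: "\<And>p. p \<in> polys_over R \<Longrightarrow> poly p x = 0 \<Longrightarrow> p = 0"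
    and v: "v \<in> adjoin R x" "v \<noteq> 0"
  shows "\<exists>u\<in>R. u \<noteq> 0 \<and> (\<forall>\<phi> :: 'd \<Rightarrow> 'f::field_char_0. hom_on R \<phi> \<longrightarrow> \<phi> u \<noteq> 0 \<longrightarrow>
    (\<exists>\<phi>'. hom_on (adjoin R x) \<phi>' \<and> (\<forall>c\<in>R. \<phi>' c = \<phi> c) \<and> \<phi>' v \<noteq> 0))"
proof -
  from v obtain q where q: "q \<in> polys_over R" "v = poly q x"
    by (auto simp: adjoin_def)
  show ?thesis
  proof (intro bexI[of _ "lead_coeff q"] conjI allI impI)
    show "lead_coeff q \<noteq> 0" using q v by auto
    show "lead_coeff q \<in> R" using q coeff_polys_over by blast
    fix \<phi> :: "'d \<Rightarrow> 'f"
    assume \<phi>: "hom_on R \<phi>" and nz: "\<phi> (lead_coeff q) \<noteq> 0"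
    have "coeff (map_poly \<phi> q) (degree q) \<noteq> 0"
      using nz by (simp add: coeff_map_poly hom_on_0[OF \<phi>])
    then have "map_poly \<phi> q \<noteq> 0" by fastforce
    then have "finite {\<xi>. poly (map_poly \<phi> q) \<xi> = 0}"
      by (rule poly_roots_finite)
    then obtain \<xi> where \<xi>: "poly (map_poly \<phi> q) \<xi> \<noteq> 0"
      using infinite_UNIV_char_0[where 'a = 'f] by (metis (mono_tags, lifting) UNIV_eq_I mem_Collect_eq)
    obtain \<phi>' where "hom_on (adjoin R x) \<phi>'" "\<And>c. c \<in> R \<Longrightarrow> \<phi>' c = \<phi> c"
      "\<And>p. p \<in> polys_over R \<Longrightarrow> \<phi>' (poly p x) = poly (map_poly \<phi> p) \<xi>"
      using extend_hom_to_adjoin[OF \<phi>, of x \<xi>] tr by (metis map_poly_0 poly_0)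
    with q \<xi> show "\<exists>\<phi>'. hom_on (adjoin R x) \<phi>' \<and> (\<forall>c\<in>R. \<phi>' c = \<phi> c) \<and> \<phi>' v \<noteq> 0"
      by auto
  qed
qed

text \<open>
  The element \<open>u\<close> is the leading coefficient of a minimal equation of \<open>x\<close> times a nonzero element of \<open>R\<close> that is a
  multiple of \<open>v\<close> in \<open>R[x]\<close>.
\<close>

lemma extend_hom_algebraic:
  assumes alg: "p1 \<in> polys_over R" "p1 \<noteq> 0" "poly p1 x = 0"
    and v: "v \<in> adjoin R x" "v \<noteq> 0"
  shows "\<exists>u\<in>R. u \<noteq> 0 \<and> (\<forall>\<phi> :: 'd \<Rightarrow> 'f::alg_closed_field. hom_on R \<phi> \<longrightarrow> \<phi> u \<noteq> 0 \<longrightarrow>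
    (\<exists>\<phi>'. hom_on (adjoin R x) \<phi>' \<and> (\<forall>c\<in>R. \<phi>' c = \<phi> c) \<and> \<phi>' v \<noteq> 0))"
proof -
  \<comment> \<open>A nonzero equation of least degree for \<open>x\<close> over \<open>R\<close>.
    It divides every other equation up to a power of its leading coefficient.\<close>
  define P where "P p \<longleftrightarrow> p \<in> polys_over R \<and> p \<noteq> 0 \<and> poly p x = 0" for p
  obtain p0 where "P p0" and p0_min: "\<And>p. P p \<Longrightarrow> degree p0 \<le> degree p"
    using ex_has_least_nat[of P p1 degree] alg by (auto simp: P_def)
  then have p0: "p0 \<in> polys_over R" "p0 \<noteq> 0" "poly p0 x = 0"
    by (auto simp: P_def)
  have small: "poly p x \<noteq> 0" if "p \<in> polys_over R" "p \<noteq> 0" "degree p < degree p0" for p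
    using p0_min[of p] that by (auto simp: P_def)
  have deg_p0: "degree p0 > 0"
  proof (rule ccontr)
    assume "\<not> degree p0 > 0"
    then obtain c where "p0 = [:c:]" by (auto elim: degree_eq_zeroE)
    with p0 show False by simp
  qed
  let ?a = "lead_coeff p0"
  have a: "?a \<in> R" "?a \<noteq> 0"
    using p0 coeff_polys_over by auto
  from v obtain q where q: "q \<in> polys_over R" "v = poly q x"
    by (auto simp: adjoin_def)
  \<comment> \<open>Reduced polynomials whose value at \<open>x\<close> is a multiple of
    \<open>v\<close>. One of least degree turns out to be constant, so \<open>v\<close> divides a
    nonzero element of \<open>R\<close>.\<close>
  define J where "J r \<longleftrightarrow> r \<in> polys_over R \<and> r \<noteq> 0 \<and> degree r < degree p0 \<and>
    (\<exists>s\<in>polys_over R. poly r x = poly s x * v)" for r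
  have "\<exists>r. J r"
  proof -
    obtain k q' r where *: "q' \<in> polys_over R" "r \<in> polys_over R"
      "smult (?a ^ k) q = p0 * q' + r" "r = 0 \<or> degree r < degree p0"
      using pseudo_division_over[OF p0(1,2) q(1)] by blast
    have "?a ^ k * v = poly r x"
      using arg_cong[OF *(3), of "\<lambda>p. poly p x"] p0 q by simp
    then have "poly r x = poly [:?a ^ k:] x * v" "r \<noteq> 0"
      using a v by auto
    then show ?thesis
      using * a unfolding J_def by (metis polys_over_closed(2) subring_power)
  qed
  then obtain r where "J r" and r_min: "\<And>r'. J r' \<Longrightarrow> degree r \<le> degree r'"
    using ex_has_least_nat[of J _ degree] by blast
  then obtain s where r: "r \<in> polys_over R" "r \<noteq> 0" "degree r < degree p0"
    and s: "s \<in> polys_over R" "poly r x = poly s x * v"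
    by (auto simp: J_def)
  have "degree r = 0"
  proof (rule ccontr)
    assume pos: "degree r \<noteq> 0"
    \<comment> \<open>The remainder of \<open>p0\<close> on division by \<open>r\<close> again
      represents a multiple of \<open>v\<close>, so it vanishes by minimality; then
      \<open>q'\<close> is an equation for \<open>x\<close> of degree below that of
      \<open>p0\<close>.\<close>
    obtain k q' r' where *: "q' \<in> polys_over R" "r' \<in> polys_over R"
      "smult (lead_coeff r ^ k) p0 = r * q' + r'" "r' = 0 \<or> degree r' < degree r"
      using pseudo_division_over[OF r(1,2) p0(1)] by blast
    have ev: "poly r x * poly q' x + poly r' x = 0"
      using arg_cong[OF *(3), of "\<lambda>p. poly p x"] p0 by simp
    then have "poly r' x = - (poly r x * poly q' x)"
      by (simp add: eq_neg_iff_add_eq_0 add.commute)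
    then have "poly r' x = poly (- (s * q')) x * v"
      by (simp add: s)
    then have "r' = 0"
      using * s(1) r_min[of r'] r(3) unfolding J_def
      by (metis leD less_trans polys_over_closed(6) polys_over_closed(7))
    then have "poly q' x = 0"
      using ev small[OF r] by simp
    have "smult (lead_coeff r ^ k) p0 = r * q'"
      using * \<open>r' = 0\<close> by simp
    moreover have "smult (lead_coeff r ^ k) p0 \<noteq> 0"
      using r p0 by simp
    ultimately have "q' \<noteq> 0" "degree p0 = degree r + degree q'"
      using r by (auto simp: degree_mult_eq dest: arg_cong[where f = degree])
    then show False
      using small[of q'] * \<open>poly q' x = 0\<close> pos by simp
  qed
  then obtain c where c: "r = [:c:]"
    by (rule degree_eq_zeroE)
  then have cR: "c \<in> R" "c \<noteq> 0" and cv: "c = poly s x * v"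
    using r s coeff_polys_over[of r 0] by auto
  show ?thesis
  proof (intro bexI[of _ "?a * c"] conjI allI impI)
    show "?a * c \<noteq> 0" "?a * c \<in> R"
      using a cR subring_closed by auto
    fix \<phi> :: "'d \<Rightarrow> 'f"
    assume \<phi>: "hom_on R \<phi>" and "\<phi> (?a * c) \<noteq> 0"
    then have nz: "\<phi> ?a \<noteq> 0" "\<phi> c \<noteq> 0"
      using a cR by (auto simp: hom_on_simps[OF \<phi>])
    have "coeff (map_poly \<phi> p0) (degree p0) \<noteq> 0"
      using nz by (simp add: coeff_map_poly hom_on_0[OF \<phi>])
    then have "degree (map_poly \<phi> p0) > 0"
      using deg_p0 le_degree by fastforce
    \<comment> \<open>A root of the specialized minimal equation, whose degree stays positive
      because \<open>\<phi>\<close> does not kill the leading coefficient.\<close>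
    then obtain \<xi> where \<xi>: "poly (map_poly \<phi> p0) \<xi> = 0"
      using alg_closed_imp_poly_has_root by blast
    have wd: "poly (map_poly \<phi> p) \<xi> = 0" if p: "p \<in> polys_over R" "poly p x = 0" for p
    proof -
      obtain k q' r where *: "q' \<in> polys_over R" "r \<in> polys_over R"
        "smult (?a ^ k) p = p0 * q' + r" "r = 0 \<or> degree r < degree p0"
        using pseudo_division_over[OF p0(1,2) p(1)] by blast
      have "poly r x = 0"
        using arg_cong[OF *(3), of "\<lambda>p. poly p x"] p0 p by simp
      then have "r = 0"
        using * small by blast
      then have "smult (\<phi> ?a ^ k) (map_poly \<phi> p) = map_poly \<phi> p0 * map_poly \<phi> q'"
        using arg_cong[OF *(3), of "map_poly \<phi>"] map_poly_hom_smult[OF \<phi> subring_power[OF a(1)] p(1)]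
          map_poly_hom_mult[OF \<phi> p0(1) *(1)] hom_on_power[OF \<phi> a(1)] by simp
      then have "\<phi> ?a ^ k * poly (map_poly \<phi> p) \<xi> = 0"
        using \<xi> by (metis mult_zero_left poly_mult poly_smult)
      then show ?thesis using nz by simp
    qed
    obtain \<phi>' where \<phi>': "hom_on (adjoin R x) \<phi>'" "\<And>c. c \<in> R \<Longrightarrow> \<phi>' c = \<phi> c"
      using extend_hom_to_adjoin[OF \<phi> wd] by metis
    have "poly s x \<in> adjoin R x"
      using s by (auto simp: adjoin_def)
    \<comment> \<open>Since \<open>c\<close> is a multiple of \<open>v\<close> and
      \<open>\<phi>\<close> does not vanish at \<open>c\<close>, the extension cannot vanish at
      \<open>v\<close>.\<close>
    then have "\<phi> c = \<phi>' (poly s x) * \<phi>' v"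
      using \<phi>' cR cv v(1) unfolding hom_on_def by metis
    then show "\<exists>\<phi>'. hom_on (adjoin R x) \<phi>' \<and> (\<forall>c\<in>R. \<phi>' c = \<phi> c) \<and> \<phi>' v \<noteq> 0"
      using \<phi>' nz by auto
  qed
qed

lemma extend_hom_step:
  assumes "v \<in> adjoin R x" "v \<noteq> 0"
  shows "\<exists>u\<in>R. u \<noteq> 0 \<and> (\<forall>\<phi> :: 'd \<Rightarrow> 'f::{alg_closed_field, field_char_0}. hom_on R \<phi> \<longrightarrow> \<phi> u \<noteq> 0 \<longrightarrow>
    (\<exists>\<phi>'. hom_on (adjoin R x) \<phi>' \<and> (\<forall>c\<in>R. \<phi>' c = \<phi> c) \<and> \<phi>' v \<noteq> 0))"
  using extend_hom_transcendental[of x v] extend_hom_algebraic[of _ x v] assms by blast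

end

section \<open>Towers of simple extensions\<close>

lemma is_subring_foldl_adjoin: "is_subring R \<Longrightarrow> is_subring (foldl adjoin (R :: 'd::idom set) xs)"
  by (induction xs arbitrary: R) (auto simp: is_subring_adjoin)

lemma subset_foldl_adjoin: "is_subring R \<Longrightarrow> (R :: 'd::idom set) \<subseteq> foldl adjoin R xs"
proof (induction xs arbitrary: R)
  case (Cons x xs)
  then show ?case
    using subset_adjoin[OF Cons.prems, of x] Cons.IH[OF is_subring_adjoin[OF Cons.prems, of x]] by auto
qed simp

lemma set_subset_foldl_adjoin: "is_subring R \<Longrightarrow> set xs \<subseteq> foldl adjoin (R :: 'd::idom set) xs"
proof (induction xs arbitrary: R)
  case (Cons x xs)
  have sub: "is_subring (adjoin R x)"
    by (rule is_subring_adjoin[OF Cons.prems])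
  then have "x \<in> foldl adjoin (adjoin R x) xs"
    using mem_adjoin[OF Cons.prems, of x] subset_foldl_adjoin by blast
  with Cons.IH[OF sub] show ?case by auto
qed simp

text \<open>The extension theorem for homomorphisms of domains into an algebraically closed field.
  The nonvanishing condition moves down the tower: the element \<open>w\<close> found for the
  remaining generators becomes the one to keep nonzero when \<open>x\<close> is adjoined.\<close>

lemma extend_hom:
  fixes R :: "'d::idom set"
  assumes "is_subring R" "v \<in> foldl adjoin R xs" "v \<noteq> 0"
  shows "\<exists>u\<in>R. u \<noteq> 0 \<and> (\<forall>\<phi> :: 'd \<Rightarrow> 'f::{alg_closed_field, field_char_0}. hom_on R \<phi> \<longrightarrow> \<phi> u \<noteq> 0 \<longrightarrow>
    (\<exists>\<phi>'. hom_on (foldl adjoin R xs) \<phi>' \<and> (\<forall>c\<in>R. \<phi>' c = \<phi> c) \<and> \<phi>' v \<noteq> 0))"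
  using assms
proof (induction xs arbitrary: R)
  case Nil
  then show ?case by (intro bexI[of _ v]) auto
next
  case (Cons x xs)
  let ?S = "adjoin R x"
  from Cons.IH[of ?S] Cons.prems obtain w where w: "w \<in> ?S" "w \<noteq> 0"
    "\<And>\<phi> :: 'd \<Rightarrow> 'f. hom_on ?S \<phi> \<Longrightarrow> \<phi> w \<noteq> 0 \<Longrightarrow>
      \<exists>\<phi>'. hom_on (foldl adjoin ?S xs) \<phi>' \<and> (\<forall>c\<in>?S. \<phi>' c = \<phi> c) \<and> \<phi>' v \<noteq> 0"
    by (auto simp: is_subring_adjoin)
  from extend_hom_step[OF Cons.prems(1) w(1,2), where 'f = 'f] obtain u where u: "u \<in> R" "u \<noteq> 0"
    "\<And>\<phi> :: 'd \<Rightarrow> 'f. hom_on R \<phi> \<Longrightarrow> \<phi> u \<noteq> 0 \<Longrightarrow>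
      \<exists>\<phi>'. hom_on ?S \<phi>' \<and> (\<forall>c\<in>R. \<phi>' c = \<phi> c) \<and> \<phi>' w \<noteq> 0"
    by blast
  show ?case
  proof (intro bexI[of _ u] conjI allI impI)
    fix \<phi> :: "'d \<Rightarrow> 'f" assume "hom_on R \<phi>" "\<phi> u \<noteq> 0"
    with u(3) obtain \<phi>1 where 1: "hom_on ?S \<phi>1" "\<forall>c\<in>R. \<phi>1 c = \<phi> c" "\<phi>1 w \<noteq> 0" by blast
    with w(3) obtain \<phi>2 where 2: "hom_on (foldl adjoin ?S xs) \<phi>2" "\<forall>c\<in>?S. \<phi>2 c = \<phi>1 c" "\<phi>2 v \<noteq> 0"
      by blast
    with 1 show "\<exists>\<phi>'. hom_on (foldl adjoin R (x # xs)) \<phi>' \<and> (\<forall>c\<in>R. \<phi>' c = \<phi> c) \<and> \<phi>' v \<noteq> 0"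
      using subset_adjoin[OF Cons.prems(1), of x] by (intro exI[of _ \<phi>2]) auto
  qed (use u in auto)
qed

section \<open>The integral domain of polynomial functions\<close>

inductive polyfun :: "'i set \<Rightarrow> (('i \<Rightarrow> 'f::field) \<Rightarrow> 'f) \<Rightarrow> bool" for J where
  const: "polyfun J (\<lambda>t. c)"
| var: "i \<in> J \<Longrightarrow> polyfun J (\<lambda>t. t i)"
| add: "polyfun J f \<Longrightarrow> polyfun J g \<Longrightarrow> polyfun J (\<lambda>t. f t + g t)"
| mult: "polyfun J f \<Longrightarrow> polyfun J g \<Longrightarrow> polyfun J (\<lambda>t. f t * g t)"

lemma polyfun_uminus: "polyfun J f \<Longrightarrow> polyfun J (\<lambda>t. - f t)"
  using polyfun.mult[OF polyfun.const[of J "-1"]] by simp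

lemma polyfun_sum: "(\<And>i. i \<in> I \<Longrightarrow> polyfun J (f i)) \<Longrightarrow> polyfun J (\<lambda>t. \<Sum>i\<in>I. f i t)"
  by (induction I rule: infinite_finite_induct) (auto intro: polyfun.intros)

lemma polyfun_mono: "polyfun J f \<Longrightarrow> J \<subseteq> K \<Longrightarrow> polyfun K f"
  by (induction rule: polyfun.induct) (auto intro: polyfun.intros)

lemma polyfun_on_line:
  "polyfun J f \<Longrightarrow> \<exists>p. \<forall>z. f (\<lambda>i. a i + z * b i) = poly p z"
proof (induction rule: polyfun.induct)
  case (const c)
  show ?case by (intro exI[of _ "[:c:]"]) simp
next
  case (var i)
  show ?case by (intro exI[of _ "[:a i, b i:]"]) simp
next
  case (add f g)
  then show ?case by (metis poly_add)
next
  case (mult f g)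
  then show ?case by (metis poly_mult)
qed

text \<open>On the line joining \<open>a\<close> to \<open>b\<close> both functions are univariate
  polynomials, neither of them zero; their product then has a nonzero value, the field being
  infinite.\<close>

lemma polyfun_no_zero_divisors:
  fixes f g :: "('i \<Rightarrow> 'f::field_char_0) \<Rightarrow> 'f"
  assumes "polyfun J f" "polyfun J g" "f a \<noteq> 0" "g b \<noteq> 0"
  shows "\<exists>t. f t * g t \<noteq> 0"
proof -
  let ?l = "\<lambda>z i. a i + z * (b i - a i)"
  obtain p q where p: "\<And>z. f (?l z) = poly p z" and q: "\<And>z. g (?l z) = poly q z"
    using polyfun_on_line[OF assms(1), of a "\<lambda>i. b i - a i"] polyfun_on_line[OF assms(2), of a "\<lambda>i. b i - a i"]
    by blast
  have "poly p 0 \<noteq> 0" "poly q 1 \<noteq> 0"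
    using assms p[of 0] q[of 1] by auto
  then have "p * q \<noteq> 0" by auto
  then obtain z where "poly (p * q) z \<noteq> 0"
    using poly_all_0_iff_0 by blast
  then show ?thesis
    using p q by (intro exI[of _ "?l z"]) simp
qed

text \<open>Functions instead of formal polynomials: two trace polynomials then give the same
  element exactly when they agree on all homogeneous tuples, which is what identities control. In
  characteristic zero these functions still form an integral domain, as \<open>extend_hom\<close>
  requires.\<close>

typedef (overloaded) ('i, 'f::field) pfun = "{f :: ('i \<Rightarrow> 'f) \<Rightarrow> 'f. polyfun UNIV f}"
  morphisms peval Pfun
  using polyfun.const by blast

setup_lifting type_definition_pfun

instantiation pfun :: (type, field) comm_ring_1
begin

lift_definition zero_pfun :: "('a, 'b) pfun" is "\<lambda>t. 0" by (rule polyfun.const)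
lift_definition one_pfun :: "('a, 'b) pfun" is "\<lambda>t. 1" by (rule polyfun.const)
lift_definition plus_pfun :: "('a, 'b) pfun \<Rightarrow> ('a, 'b) pfun \<Rightarrow> ('a, 'b) pfun" is "\<lambda>f g t. f t + g t"
  by (rule polyfun.add)
lift_definition times_pfun :: "('a, 'b) pfun \<Rightarrow> ('a, 'b) pfun \<Rightarrow> ('a, 'b) pfun" is "\<lambda>f g t. f t * g t"
  by (rule polyfun.mult)
lift_definition uminus_pfun :: "('a, 'b) pfun \<Rightarrow> ('a, 'b) pfun" is "\<lambda>f t. - f t"
  by (rule polyfun_uminus)
lift_definition minus_pfun :: "('a, 'b) pfun \<Rightarrow> ('a, 'b) pfun \<Rightarrow> ('a, 'b) pfun" is "\<lambda>f g t. f t - g t"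
  using polyfun.add polyfun_uminus by fastforce

instance
  by standard (transfer; simp add: fun_eq_iff algebra_simps)+

end

instance pfun :: (type, field_char_0) idom
proof
  fix f g :: "('a, 'b) pfun"
  assume "f \<noteq> 0" "g \<noteq> 0"
  then show "f * g \<noteq> 0"
    by transfer (use polyfun_no_zero_divisors in \<open>fastforce simp: fun_eq_iff\<close>)
qed

lemma peval_simps [simp]:
  "peval 0 t = 0" "peval 1 t = 1" "peval (f + g) t = peval f t + peval g t"
  "peval (f * g) t = peval f t * peval g t" "peval (- f) t = - peval f t"
  by (transfer; simp)+

lemma pfun_eqI: "(\<And>t. peval f t = peval g t) \<Longrightarrow> f = g"
  by transfer auto

lemma peval_Pfun: "polyfun J f \<Longrightarrow> peval (Pfun f) = f"
  using Pfun_inverse polyfun_mono by blast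

lemma polyfun_mem_subring:
  fixes S :: "('i, 'f::field) pfun set"
  assumes S: "is_subring S" and c: "\<And>c. Pfun (\<lambda>t. c) \<in> S" and v: "\<And>i. i \<in> J \<Longrightarrow> Pfun (\<lambda>t. t i) \<in> S"
    and f: "polyfun J f"
  shows "Pfun f \<in> S"
  using f
proof (induction rule: polyfun.induct)
  case (add f g)
  have "Pfun (\<lambda>t. f t + g t) = Pfun f + Pfun g"
    by (rule pfun_eqI) (simp add: peval_Pfun[OF polyfun.add[OF add.hyps]] peval_Pfun[OF add.hyps(1)] peval_Pfun[OF add.hyps(2)])
  with add S show ?case by (auto simp: is_subring_def)
next
  case (mult f g)
  have "Pfun (\<lambda>t. f t * g t) = Pfun f * Pfun g"
    by (rule pfun_eqI) (simp add: peval_Pfun[OF polyfun.mult[OF mult.hyps]] peval_Pfun[OF mult.hyps(1)] peval_Pfun[OF mult.hyps(2)])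
  with mult S show ?case by (auto simp: is_subring_def)
qed (use c v in auto)

text \<open>This turns a homomorphism back into a point: a polynomial function is built from
  constants, which \<open>\<chi>\<close> fixes, and coordinate functions, whose images are the
  coordinates of that point.\<close>

lemma hom_on_polyfun:
  fixes S :: "('i, 'f::field) pfun set"
  assumes S: "is_subring S" and c: "\<And>c. Pfun (\<lambda>t. c) \<in> S" and v: "\<And>i. i \<in> J \<Longrightarrow> Pfun (\<lambda>t. t i) \<in> S"
    and \<chi>: "hom_on S \<chi>" "\<And>c. \<chi> (Pfun (\<lambda>t. c)) = c" and f: "polyfun J f"
  shows "\<chi> (Pfun f) = f (\<lambda>i. \<chi> (Pfun (\<lambda>t. t i)))"
  using f
proof (induction rule: polyfun.induct)
  case (add f g)
  have "Pfun (\<lambda>t. f t + g t) = Pfun f + Pfun g"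
    by (rule pfun_eqI) (simp add: peval_Pfun[OF polyfun.add[OF add.hyps]] peval_Pfun[OF add.hyps(1)] peval_Pfun[OF add.hyps(2)])
  with add show ?case
    using \<chi>(1) polyfun_mem_subring[OF S c v] by (auto simp: hom_on_def)
next
  case (mult f g)
  have "Pfun (\<lambda>t. f t * g t) = Pfun f * Pfun g"
    by (rule pfun_eqI) (simp add: peval_Pfun[OF polyfun.mult[OF mult.hyps]] peval_Pfun[OF mult.hyps(1)] peval_Pfun[OF mult.hyps(2)])
  with mult show ?case
    using \<chi>(1) polyfun_mem_subring[OF S c v] by (auto simp: hom_on_def)
qed (use \<chi> in auto)

section \<open>Density for graded simple algebras\<close>

text \<open>A property of families, not of sets: in a finite family a repeated vector is a
  dependence. The indices will also carry degrees.\<close>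

definition (in vector_space) lin_indep :: "'i set \<Rightarrow> ('i \<Rightarrow> 'b) \<Rightarrow> bool" where
  "lin_indep I x \<longleftrightarrow> (\<forall>c. (\<Sum>i\<in>I. c i *s x i) = 0 \<longrightarrow> (\<forall>i\<in>I. c i = 0))"

context vector_space
begin

lemma lin_indepD: "lin_indep I x \<Longrightarrow> (\<Sum>i\<in>I. c i *s x i) = 0 \<Longrightarrow> i \<in> I \<Longrightarrow> c i = 0"
  unfolding lin_indep_def by blast

lemma lin_indep_subset:
  assumes "lin_indep I x" "finite I" "J \<subseteq> I" shows "lin_indep J x"
  unfolding lin_indep_def
proof (intro allI impI ballI)
  fix c j assume c: "(\<Sum>i\<in>J. c i *s x i) = 0" and j: "j \<in> J"
  have "(\<Sum>i\<in>I. (if i \<in> J then c i else 0) *s x i) = (\<Sum>i\<in>J. c i *s x i)"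
    using assms by (intro sum.mono_neutral_cong_right) auto
  from lin_indepD[OF assms(1), of "\<lambda>i. if i \<in> J then c i else 0" j] this c j assms(3)
  show "c j = 0" by auto
qed

lemma card_le_if_lin_indep:
  assumes I: "finite I" "lin_indep I x" and fd: "finite_dimensional_vector_space scale basis"
  shows "card I \<le> card basis"
proof -
  interpret finite_dimensional_vector_space scale basis by (rule fd)
  have inj: "inj_on x I"
  proof (rule inj_onI, rule ccontr)
    fix i j assume ij: "i \<in> I" "j \<in> I" "x i = x j" "i \<noteq> j"
    have "(\<Sum>k\<in>I. ((if k = i then 1 else 0) - (if k = j then 1 else 0)) *s x k) = x i - x j"
      using I ij by (simp add: scale_left_diff_distrib sum_subtractf if_distrib[of "\<lambda>c. c *s _"] cong: if_cong)
    then show False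
      using lin_indepD[OF I(2), of "\<lambda>k. (if k = i then 1 else 0) - (if k = j then 1 else 0)" i] ij by simp
  qed
  have "independent (x ` I)"
  proof
    assume "dependent (x ` I)"
    then obtain u v where uv: "v \<in> x ` I" "u v \<noteq> 0" "(\<Sum>v\<in>x ` I. u v *s v) = 0"
      using dependent_finite[of "x ` I"] I by auto
    then have "(\<Sum>i\<in>I. u (x i) *s x i) = 0"
      using sum.reindex[OF inj, of "\<lambda>v. u v *s v"] by simp
    with uv lin_indepD[OF I(2), of "\<lambda>i. u (x i)"] show False by auto
  qed
  moreover have "x ` I \<subseteq> span basis"
    using span_Basis by simp
  ultimately have "card (x ` I) \<le> card basis"
    using independent_span_bound[OF finite_Basis] by blast
  then show ?thesis
    using card_image[OF inj] by simp
qed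

end

text \<open>Let \<open>p\<close> be a nonzero polynomial of least degree with
  \<open>app p = 0\<close>, that is, \<open>p(T) v = 0\<close>. It has a root \<open>r\<close>, and
  \<open>p = [:- r, 1:] * q\<close> makes \<open>q(T) v\<close> an eigenvector, nonzero by
  minimality.\<close>

lemma eigenvector_exists:
  fixes scale :: "'f::alg_closed_field \<Rightarrow> 'b::ab_group_add \<Rightarrow> 'b" (infixr \<open>*s\<close> 75)
    and T :: "'b \<Rightarrow> 'b" and v :: 'b
  assumes fd: "finite_dimensional_vector_space scale basis"
    and T: "module_hom (*s) (*s) T" and v: "v \<noteq> 0"
  shows "\<exists>c w. w \<noteq> 0 \<and> T w = c *s w"
proof -
  interpret finite_dimensional_vector_space scale basis by (rule fd)
  define app where "app p = (\<Sum>k\<le>degree p. coeff p k *s (T ^^ k) v)" for p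
  define P where "P p \<longleftrightarrow> p \<noteq> 0 \<and> app p = 0" for p
  have "\<exists>p. P p"
  proof -
    have "\<not> lin_indep {..card basis} (\<lambda>k. (T ^^ k) v)"
      using card_le_if_lin_indep[OF _ _ fd, of "{..card basis}"] by fastforce
    then obtain c i where c: "(\<Sum>k\<le>card basis. c k *s (T ^^ k) v) = 0" "i \<le> card basis" "c i \<noteq> 0"
      by (auto simp: lin_indep_def)
    define p where "p = (\<Sum>k\<le>card basis. monom (c k) k)"
    have coeff: "coeff p k = (if k \<le> card basis then c k else 0)" for k
      by (simp add: p_def coeff_sum)
    then have c_eq: "c k = coeff p k" if "k \<le> card basis" for k
      using that by simp
    have "p \<noteq> 0" "degree p \<le> card basis"
      using c coeff by (auto intro!: degree_le simp: poly_eq_iff)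
    moreover have "app p = (\<Sum>k\<le>card basis. c k *s (T ^^ k) v)"
      unfolding app_def using \<open>degree p \<le> card basis\<close>
      by (intro sum.mono_neutral_cong_left) (auto simp: coeff_eq_0 c_eq)
    ultimately show ?thesis
      using c by (auto simp: P_def)
  qed
  then obtain p where "P p" and p_min: "\<And>q. P q \<Longrightarrow> degree p \<le> degree q"
    using ex_has_least_nat[of P _ degree] by blast
  then have p: "p \<noteq> 0" "app p = 0"
    by (auto simp: P_def)
  have "degree p > 0"
  proof (rule ccontr)
    assume "\<not> degree p > 0"
    with p v show False
      using leading_coeff_0_iff[of p] by (auto simp: app_def)
  qed
  then obtain r where "poly p r = 0"
    using alg_closed_imp_poly_has_root by blast
  then obtain q where q: "p = [:- r, 1:] * q"
    by (metis dvd_def poly_eq_0_iff_dvd)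
  with p have "q \<noteq> 0" by auto
  then have deg: "degree p = Suc (degree q)"
    by (simp add: q degree_mult_eq del: mult_pCons_left)
  define w where "w = app q"
  have "w \<noteq> 0"
    using p_min[of q] \<open>q \<noteq> 0\<close> deg by (auto simp: w_def P_def)
  moreover have "T w = r *s w"
  proof -
    \<comment> \<open>The coefficients of \<open>[:- r, 1:] * q\<close> are those of
      \<open>q\<close> shifted by one, minus \<open>r\<close> times those of \<open>q\<close>; the
      shifted sum is \<open>T w\<close>.\<close>
    have "app p = (\<Sum>k\<le>Suc (degree q). coeff (pCons 0 q) k *s (T ^^ k) v - r *s (coeff q k *s (T ^^ k) v))"
      unfolding app_def deg by (simp add: q scale_left_diff_distrib)
    also have "\<dots> = (\<Sum>k\<le>Suc (degree q). coeff (pCons 0 q) k *s (T ^^ k) v) -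
        (\<Sum>k\<le>Suc (degree q). r *s (coeff q k *s (T ^^ k) v))"
      by (rule sum_subtractf)
    also have "(\<Sum>k\<le>Suc (degree q). coeff (pCons 0 q) k *s (T ^^ k) v) = T w"
      by (subst sum.atMost_Suc_shift)
        (simp add: w_def app_def module_hom.sum[OF T] module_hom.scale[OF T])
    also have "(\<Sum>k\<le>Suc (degree q). r *s (coeff q k *s (T ^^ k) v)) = r *s w"
      by (simp add: w_def app_def scale_sum_right coeff_eq_0)
    finally show ?thesis using p by simp
  qed
  ultimately show ?thesis by blast
qed

context assoc_algebra
begin

lemma module_hom_comp: "module_hom (*s) (*s) S \<Longrightarrow> module_hom (*s) (*s) T \<Longrightarrow> module_hom (*s) (*s) (\<lambda>x. S (T x))"
  by (simp add: module_hom_iff)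

lemma module_hom_sum: "(\<And>i. i \<in> I \<Longrightarrow> module_hom (*s) (*s) (T i)) \<Longrightarrow> module_hom (*s) (*s) (\<lambda>x. \<Sum>i\<in>I. T i x)"
  by (auto simp: module_hom_iff module_axioms sum.distrib scale_sum_right)

lemma module_hom_scaled: "module_hom (*s) (*s) T \<Longrightarrow> module_hom (*s) (*s) (\<lambda>x. c *s T x)"
  by (auto simp: module_hom_iff scale_right_distrib scale_left_commute)

lemma module_hom_expand:
  assumes T: "module_hom (*s) (*s) T"
  shows "T (\<Sum>i\<in>I. c i *s x i) = (\<Sum>i\<in>I. c i *s T (x i))"
  by (simp add: module_hom.sum[OF T] module_hom.scale[OF T])

lemma module_hom_0: "module_hom (*s) (*s) (\<lambda>x. 0)"
  and module_hom_id: "module_hom (*s) (*s) (\<lambda>x. x)"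
  and module_hom_mult_left: "module_hom (*s) (*s) (\<lambda>x. a * x)"
  and module_hom_mult_right: "module_hom (*s) (*s) (\<lambda>x. x * a)"
  by (auto simp: module_hom_iff module_axioms algebra_simps scale_mult_left scale_mult_right)

end

section \<open>Homogeneous parts and two-sided multiplication operators\<close>

context graded_algebra
begin

definition part :: "'g \<Rightarrow> 'a \<Rightarrow> 'a" where
  "part g x = (THE c. homogeneous_decomposition comp x c) g"

lemma homogeneous_decomposition_part: "homogeneous_decomposition comp x (\<lambda>g. part g x)"
  using theI'[OF direct_sum[of x]] by (simp add: part_def)

lemma part_unique: "homogeneous_decomposition comp x c \<Longrightarrow> part g x = c g"
  using direct_sum homogeneous_decomposition_part by metis

lemma part_in: "part g x \<in> comp g"
  and finite_part: "finite {g. part g x \<noteq> 0}"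
  and sum_part: "(\<Sum>g | part g x \<noteq> 0. part g x) = x"
  using homogeneous_decomposition_part[of x] unfolding homogeneous_decomposition_def by auto

lemma comp_0: "0 \<in> comp g"
  and comp_add: "x \<in> comp g \<Longrightarrow> y \<in> comp g \<Longrightarrow> x + y \<in> comp g"
  and comp_scale: "x \<in> comp g \<Longrightarrow> c *s x \<in> comp g"
  using subspace_comp[of g] by (auto intro: subspace_0 subspace_add subspace_scale)

lemma comp_sum: "(\<And>i. i \<in> I \<Longrightarrow> f i \<in> comp g) \<Longrightarrow> (\<Sum>i\<in>I. f i) \<in> comp g"
  by (rule subspace_sum[OF subspace_comp])

lemma part_superset: "finite S \<Longrightarrow> {g. part g x \<noteq> 0} \<subseteq> S \<Longrightarrow> (\<Sum>g\<in>S. part g x) = x"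
  by (subst (2) sum_part[of x, symmetric], intro sum.mono_neutral_right) auto

lemma part_eqI:
  assumes "\<And>g. c g \<in> comp g" "finite S" "\<And>g. g \<notin> S \<Longrightarrow> c g = 0" "(\<Sum>g\<in>S. c g) = x"
  shows "part g x = c g"
proof (rule part_unique)
  have "{g. c g \<noteq> 0} \<subseteq> S" using assms by auto
  moreover have "(\<Sum>g | c g \<noteq> 0. c g) = (\<Sum>g\<in>S. c g)"
    using assms calculation by (intro sum.mono_neutral_left) auto
  ultimately show "homogeneous_decomposition comp x c"
    using assms by (auto simp: homogeneous_decomposition_def intro: finite_subset)
qed

lemma part_of_homogeneous: "x \<in> comp g \<Longrightarrow> part h x = (if h = g then x else 0)"
  by (rule part_eqI[of _ "{g}"]) (auto simp: comp_0)

lemma part_0 [simp]: "part g 0 = 0"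
  using part_of_homogeneous[OF comp_0] by auto

lemma part_add: "part g (x + y) = part g x + part g y"
  by (rule part_eqI[of _ "{g. part g x \<noteq> 0} \<union> {g. part g y \<noteq> 0}"])
    (auto simp: part_in comp_add finite_part sum.distrib part_superset)

lemma part_scale: "part g (c *s x) = c *s part g x"
  by (rule part_eqI[of _ "{g. part g x \<noteq> 0}"])
    (auto simp: part_in comp_scale finite_part sum_part simp flip: scale_sum_right)

lemma part_sum: "part g (\<Sum>i\<in>I. f i) = (\<Sum>i\<in>I. part g (f i))"
  by (induction I rule: infinite_finite_induct) (auto simp: part_add)

lemma part_mult_left:
  assumes "a \<in> comp g" shows "part (g + r) (a * x) = a * part r x"
proof -
  let ?S = "insert r {h. part h x \<noteq> 0}"
  have S: "finite ?S" by (simp add: finite_part)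
  have "part (g + r) (a * (\<Sum>h\<in>?S. part h x)) = (\<Sum>h\<in>?S. part (g + r) (a * part h x))"
    by (simp only: part_sum sum_distrib_left)
  also have "\<dots> = (\<Sum>h\<in>?S. if h = r then a * part r x else 0)"
    by (intro sum.cong refl) (auto simp: part_of_homogeneous[OF mult_comp[OF assms part_in]])
  also have "\<dots> = a * part r x"
    using S by simp
  finally show ?thesis
    by (simp only: part_superset[OF S subset_insertI])
qed

lemma part_mult_right:
  assumes "a \<in> comp g" shows "part (r + g) (x * a) = part r x * a"
proof -
  let ?S = "insert r {h. part h x \<noteq> 0}"
  have S: "finite ?S" by (simp add: finite_part)
  have "part (r + g) ((\<Sum>h\<in>?S. part h x) * a) = (\<Sum>h\<in>?S. part (r + g) (part h x * a))"
    by (simp only: part_sum sum_distrib_right)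
  also have "\<dots> = (\<Sum>h\<in>?S. if h = r then part r x * a else 0)"
    by (intro sum.cong refl) (auto simp: part_of_homogeneous[OF mult_comp[OF part_in assms]])
  also have "\<dots> = part r x * a"
    using S by simp
  finally show ?thesis
    by (simp only: part_superset[OF S subset_insertI])
qed

lemma module_hom_eqI:
  assumes "module_hom (*s) (*s) S" "module_hom (*s) (*s) T"
    and "\<And>g x. x \<in> comp g \<Longrightarrow> S x = T x"
  shows "S x = T x"
proof -
  have "S (\<Sum>g | part g x \<noteq> 0. part g x) = T (\<Sum>g | part g x \<noteq> 0. part g x)"
    by (simp only: module_hom.sum[OF assms(1)] module_hom.sum[OF assms(2)] assms(3)[OF part_in])
  then show ?thesis by (simp add: sum_part)
qed

text \<open>The span of the two-sided multiplications by homogeneous elements; homogeneity permits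
  cutting an operator down by degree in \<open>mult_ops_part\<close>. The identity map need not
  belong to it, as there may be no unit.\<close>

inductive_set mult_ops :: "('a \<Rightarrow> 'a) set" where
  zero: "(\<lambda>x. 0) \<in> mult_ops"
| step: "m \<in> mult_ops \<Longrightarrow> u \<in> comp h \<Longrightarrow> v \<in> comp k \<Longrightarrow> (\<lambda>x. m x + u * x * v) \<in> mult_ops"

lemma module_hom_mult_ops: "m \<in> mult_ops \<Longrightarrow> module_hom (*s) (*s) m"
  by (induction rule: mult_ops.induct)
    (auto simp: module_hom_iff module_axioms algebra_simps scale_mult_left scale_mult_right scale_right_distrib)

lemma mult_ops_add:
  assumes "m \<in> mult_ops" shows "m' \<in> mult_ops \<Longrightarrow> (\<lambda>x. m x + m' x) \<in> mult_ops"
  by (induction rule: mult_ops.induct)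
    (use assms mult_ops.step in \<open>fastforce simp: add.assoc[symmetric]\<close>)+

lemma mult_ops_sum: "(\<And>i. i \<in> I \<Longrightarrow> m i \<in> mult_ops) \<Longrightarrow> (\<lambda>x. \<Sum>i\<in>I. m i x) \<in> mult_ops"
  by (induction I rule: infinite_finite_induct) (auto intro: mult_ops.zero mult_ops_add)

lemma mult_ops_scale: "m \<in> mult_ops \<Longrightarrow> (\<lambda>x. c *s m x) \<in> mult_ops"
proof (induction rule: mult_ops.induct)
  case (step m u h v k)
  then show ?case
    using mult_ops.step[OF step.IH comp_scale[OF step.hyps(2), of c] step.hyps(3)]
    by (simp add: scale_right_distrib scale_mult_left)
qed (auto intro: mult_ops.zero)

lemma mult_ops_diff: "m \<in> mult_ops \<Longrightarrow> m' \<in> mult_ops \<Longrightarrow> (\<lambda>x. m x - m' x) \<in> mult_ops"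
  using mult_ops_add[OF _ mult_ops_scale[of m' "-1"], of m] by simp

lemma mult_ops_mult_left: "m \<in> mult_ops \<Longrightarrow> a \<in> comp g \<Longrightarrow> (\<lambda>x. a * m x) \<in> mult_ops"
proof (induction rule: mult_ops.induct)
  case (step m u h v k)
  then show ?case
    using mult_ops.step[OF step.IH mult_comp[OF _ step.hyps(2), of a] step.hyps(3)]
    by (simp add: distrib_left mult.assoc)
qed (auto intro: mult_ops.zero)

lemma mult_ops_mult_right: "m \<in> mult_ops \<Longrightarrow> a \<in> comp g \<Longrightarrow> (\<lambda>x. m x * a) \<in> mult_ops"
proof (induction rule: mult_ops.induct)
  case (step m u h v k)
  then show ?case
    using mult_ops.step[OF step.IH step.hyps(2) mult_comp[OF step.hyps(3), of a]]
    by (simp add: distrib_right mult.assoc)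
qed (auto intro: mult_ops.zero)

text \<open>For \<open>x\<close> of degree \<open>g\<close> the summand \<open>u * x * v\<close> has
  degree \<open>h + g + k\<close>, so \<open>m'\<close> keeps just the summands with
  \<open>h + g + k = r\<close>. Hence the choice of \<open>m'\<close> depends on
  \<open>g\<close>.\<close>

lemma mult_ops_part: "m \<in> mult_ops \<Longrightarrow> \<exists>m'\<in>mult_ops. \<forall>x\<in>comp g. m' x = part r (m x)"
proof (induction rule: mult_ops.induct)
  case (step m u h v k)
  then obtain m' where m': "m' \<in> mult_ops" "\<forall>x\<in>comp g. m' x = part r (m x)" by blast
  have *: "part r (u * x * v) = (if r = h + g + k then u * x * v else 0)" if "x \<in> comp g" for x
    using part_of_homogeneous[OF mult_comp[OF mult_comp[OF step.hyps(2) that] step.hyps(3)]] .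
  show ?case
  proof (cases "r = h + g + k")
    case True
    then show ?thesis
      using m' * by (intro bexI[OF _ mult_ops.step[OF m'(1) step.hyps(2,3)]]) (auto simp: part_add)
  next
    case False
    then show ?thesis
      using m' * by (intro bexI[OF _ m'(1)]) (auto simp: part_add)
  qed
qed (auto intro: mult_ops.zero)

end

lemma (in simple_graded_algebra) ideal_trivial:
  assumes sub: "subspace I"
    and part: "\<And>x g. x \<in> I \<Longrightarrow> part g x \<in> I"
    and left: "\<And>x a g. x \<in> I \<Longrightarrow> a \<in> comp g \<Longrightarrow> a * x \<in> I"
    and right: "\<And>x a g. x \<in> I \<Longrightarrow> a \<in> comp g \<Longrightarrow> x * a \<in> I"
  shows "I = {0} \<or> I = UNIV"
proof (rule simple)
  have "(\<Sum>g | part g a \<noteq> 0. part g a) * x \<in> I" if "x \<in> I" for a x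
    unfolding sum_distrib_right by (rule subspace_sum[OF sub]) (rule left[OF that part_in])
  moreover have "x * (\<Sum>g | part g a \<noteq> 0. part g a) \<in> I" if "x \<in> I" for a x
    unfolding sum_distrib_left by (rule subspace_sum[OF sub]) (rule right[OF that part_in])
  ultimately show "two_sided_ideal I"
    using sub by (auto simp: two_sided_ideal_def sum_part)
  show "homogeneous I"
    unfolding homogeneous_def
  proof
    fix x assume "x \<in> I"
    then show "\<exists>c. homogeneous_decomposition (\<lambda>g. I \<inter> comp g) x c"
      using homogeneous_decomposition_part[of x] part
      by (intro exI[of _ "\<lambda>g. part g x"]) (simp add: homogeneous_decomposition_def)
  qed
qed

section \<open>Graded simple algebras with nonzero multiplication\<close>

locale nonnull_simple_graded_algebra = simple_graded_algebra scale comp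
  for scale :: "'f::{alg_closed_field, field_char_0} \<Rightarrow> 'a::ring \<Rightarrow> 'a" (infixr \<open>*s\<close> 75)
    and comp :: "'g::group_add \<Rightarrow> 'a set" +
  assumes nonnull: "\<exists>x y :: 'a. x * y \<noteq> 0"
    and fin_dim: "\<exists>basis. finite_dimensional_vector_space (*s) basis"
begin

text \<open>The elements \<open>a\<close> of this kind form a homogeneous ideal, which is not the
  whole algebra because some product is nonzero.\<close>

lemma left_annihilator_trivial:
  fixes a :: 'a
  assumes "\<And>x. a * x = 0" shows "a = 0"
proof -
  let ?I = "{a :: 'a. \<forall>x. a * x = 0}"
  have "?I = {0} \<or> ?I = UNIV"
  proof (rule ideal_trivial)
    show "subspace ?I"
      by (auto simp: subspace_def distrib_right scale_mult_left)
    fix a g assume a: "a \<in> ?I"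
    have "part g a * x = 0" for x
    proof (rule module_hom_eqI[OF module_hom_mult_left module_hom_0])
      fix h x assume "x \<in> comp h"
      then show "part g a * x = 0"
        using part_mult_right[of x h g a] a by simp
    qed
    then show "part g a \<in> ?I" by simp
  qed (auto simp: mult.assoc)
  with nonnull assms show ?thesis by auto
qed

lemma right_annihilator_trivial:
  fixes a :: 'a
  assumes "\<And>x. x * a = 0" shows "a = 0"
proof -
  let ?I = "{a :: 'a. \<forall>x. x * a = 0}"
  have "?I = {0} \<or> ?I = UNIV"
  proof (rule ideal_trivial)
    show "subspace ?I"
      by (auto simp: subspace_def distrib_left scale_mult_right)
    fix a g assume a: "a \<in> ?I"
    have "x * part g a = 0" for x
    proof (rule module_hom_eqI[OF module_hom_mult_right module_hom_0])
      fix h x assume "x \<in> comp h"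
      then show "x * part g a = 0"
        using part_mult_left[of x h g a] a by simp
    qed
    then show "part g a \<in> ?I" by simp
  qed (auto simp flip: mult.assoc)
  with nonnull assms show ?thesis by auto
qed

lemma sandwich_trivial:
  assumes "\<And>h k u v. u \<in> comp h \<Longrightarrow> v \<in> comp k \<Longrightarrow> u * a * v = 0"
  shows "a = 0"
proof (rule right_annihilator_trivial)
  fix x
  show "x * a = 0"
  proof (rule module_hom_eqI[OF module_hom_mult_right module_hom_0])
    fix h u assume u: "u \<in> comp h"
    show "u * a = 0"
    proof (rule left_annihilator_trivial)
      fix y
      show "u * a * y = 0"
        by (rule module_hom_eqI[OF module_hom_mult_left module_hom_0]) (rule assms[OF u])
    qed
  qed
qed

text \<open>The eigenspaces of \<open>T\<close> are homogeneous ideals, and over an algebraically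
  closed field one of them is nonzero, hence everything.\<close>

lemma schur:
  assumes T: "module_hom (*s) (*s) T"
    and left: "\<And>x a g. a \<in> comp g \<Longrightarrow> T (a * x) = a * T x"
    and right: "\<And>x a g. a \<in> comp g \<Longrightarrow> T (x * a) = T x * a"
    and part: "\<And>x g. T (part g x) = part g (T x)"
  shows "\<exists>c. \<forall>x. T x = c *s x"
proof -
  obtain x y :: 'a where "x * y \<noteq> 0" using nonnull by blast
  then have "x \<noteq> 0" by auto
  obtain basis where fd: "finite_dimensional_vector_space (*s) basis" using fin_dim by blast
  obtain c w where w: "w \<noteq> 0" "T w = c *s w"
    using eigenvector_exists[OF fd T \<open>x \<noteq> 0\<close>] by blast
  let ?I = "{x. T x = c *s x}"
  have "?I = {0} \<or> ?I = UNIV"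
  proof (rule ideal_trivial)
    show "subspace ?I"
      by (auto simp: subspace_def module_hom.add[OF T] module_hom.zero[OF T] module_hom.scale[OF T]
          scale_right_distrib scale_left_commute)
  qed (auto simp: left right part scale_mult_left scale_mult_right part_scale)
  with w show ?thesis by auto
qed

text \<open>
  Jacobson's argument: if the value at \<open>a k\<close> is determined by the values on the other \<open>a j\<close>, it depends on each of them
  through a map in the graded centroid, i.e. through a scalar, and \<open>a k\<close> is a combination of the \<open>a j\<close>.
\<close>

lemma density:
  assumes "finite I" "\<And>i. i \<in> I \<Longrightarrow> a i \<in> comp g" "lin_indep I a"
  shows "\<exists>m\<in>mult_ops. \<forall>i\<in>I. m (a i) = b i"
  using assms
proof (induction I arbitrary: b)
  case empty
  then show ?case using mult_ops.zero by auto
next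
  case (insert k J)
  have IH: "\<exists>m\<in>mult_ops. \<forall>i\<in>J. m (a i) = b i" for b
    using insert.IH insert.prems insert.hyps(1) lin_indep_subset[OF insert.prems(2), of J] by blast
  \<comment> \<open>A homogeneous ideal. If it is everything, an operator killing the
    \<open>a j\<close> can correct the value at \<open>a k\<close>; if it is zero, the value at
    \<open>a k\<close> is determined by the values at the \<open>a j\<close>.\<close>
  let ?N = "{y. \<exists>m\<in>mult_ops. (\<forall>j\<in>J. m (a j) = 0) \<and> y = m (a k)}"
  have "?N = {0} \<or> ?N = UNIV"
  proof (rule ideal_trivial)
    show "subspace ?N"
      unfolding subspace_def
    proof (intro conjI ballI allI)
      show "0 \<in> ?N" using mult_ops.zero by auto
    next
      fix x y assume "x \<in> ?N" "y \<in> ?N"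
      then obtain m m' where "m \<in> mult_ops" "m' \<in> mult_ops" "\<forall>j\<in>J. m (a j) = 0" "\<forall>j\<in>J. m' (a j) = 0"
        "x = m (a k)" "y = m' (a k)" by blast
      then show "x + y \<in> ?N"
        by (intro CollectI bexI[OF _ mult_ops_add[of m m']]) auto
    next
      fix c x assume "x \<in> ?N"
      then obtain m where "m \<in> mult_ops" "\<forall>j\<in>J. m (a j) = 0" "x = m (a k)" by blast
      then show "c *s x \<in> ?N"
        by (intro CollectI bexI[OF _ mult_ops_scale[of m c]]) auto
    qed
  next
    fix x h assume "x \<in> ?N"
    then obtain m where m: "m \<in> mult_ops" "\<forall>j\<in>J. m (a j) = 0" "x = m (a k)" by blast
    \<comment> \<open>All \<open>a i\<close> have the same degree \<open>g\<close>, so a single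
      \<open>m'\<close> takes the part of degree \<open>h\<close> at all of them.\<close>
    obtain m' where "m' \<in> mult_ops" "\<forall>x\<in>comp g. m' x = part h (m x)"
      using mult_ops_part[OF m(1)] by blast
    with m insert.prems show "part h x \<in> ?N"
      by (intro CollectI bexI[of _ m']) auto
  next
    fix x u h assume "x \<in> ?N" and u: "u \<in> comp h"
    then obtain m where "m \<in> mult_ops" "\<forall>j\<in>J. m (a j) = 0" "x = m (a k)" by blast
    then show "u * x \<in> ?N" "x * u \<in> ?N"
      using bexI[OF _ mult_ops_mult_left[OF _ u, of m]] bexI[OF _ mult_ops_mult_right[OF _ u, of m]] by auto
  qed
  then show ?case
  proof
    assume N: "?N = UNIV"
    obtain m1 where m1: "m1 \<in> mult_ops" "\<forall>i\<in>J. m1 (a i) = b i"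
      using IH by blast
    have "b k - m1 (a k) \<in> ?N" using N by blast
    then obtain m2 where m2: "m2 \<in> mult_ops" "\<forall>j\<in>J. m2 (a j) = 0" "b k - m1 (a k) = m2 (a k)"
      by blast
    then have "m1 (a k) + m2 (a k) = b k" by (simp flip: m2(3))
    with m1 m2 show ?thesis
      by (intro bexI[OF _ mult_ops_add[OF m1(1) m2(1)]]) auto
  next
    assume N: "?N = {0}"
    have determined: "m (a k) = m' (a k)"
      if "m \<in> mult_ops" "m' \<in> mult_ops" "\<And>j. j \<in> J \<Longrightarrow> m (a j) = m' (a j)" for m m'
    proof -
      have "m (a k) - m' (a k) \<in> ?N"
        using that by (intro CollectI bexI[OF _ mult_ops_diff[of m m']]) auto
      with N show ?thesis by auto
    qed
    \<comment> \<open>\<open>T j y\<close> is the value forced at \<open>a k\<close> by the value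
      \<open>y\<close> at \<open>a j\<close> and 0 at the other \<open>a i\<close>. Being forced, it
      is compatible with homogeneous multiplications and with taking parts, so \<open>schur\<close>
      applies to \<open>T j\<close>.\<close>
    define unit_op where "unit_op j y m \<longleftrightarrow> m \<in> mult_ops \<and> (\<forall>i\<in>J. m (a i) = (if i = j then y else 0))" for j y m
    define T where "T j y = (SOME m. unit_op j y m) (a k)" for j y
    have ex_unit_op: "\<exists>m. unit_op j y m" for j y
      using IH[of "\<lambda>i. if i = j then y else 0"] by (auto simp: unit_op_def)
    have T_eq: "T j y = m (a k)" if "unit_op j y m" for j y m
    proof -
      define m' where "m' = (SOME m. unit_op j y m)"
      have "unit_op j y m'"
        unfolding m'_def by (rule someI_ex[OF ex_unit_op])
      with that have "m' (a k) = m (a k)"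
        using determined[of m' m] by (simp add: unit_op_def)
      then show ?thesis
        by (simp add: T_def m'_def)
    qed
    have "\<exists>c. \<forall>y. T j y = c *s y" for j
    proof (rule schur)
      have "T j (x + y) = T j x + T j y" for x y
      proof -
        obtain m m' where "unit_op j x m" "unit_op j y m'" using ex_unit_op by metis
        moreover from this have "unit_op j (x + y) (\<lambda>z. m z + m' z)"
          by (auto simp: unit_op_def mult_ops_add)
        ultimately show ?thesis by (simp add: T_eq)
      qed
      moreover have "T j (c *s x) = c *s T j x" for c x
      proof -
        obtain m where "unit_op j x m" using ex_unit_op by metis
        moreover from this have "unit_op j (c *s x) (\<lambda>z. c *s m z)"
          by (auto simp: unit_op_def mult_ops_scale)
        ultimately show ?thesis by (simp add: T_eq)
      qed
      ultimately show "module_hom (*s) (*s) (T j)"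
        by (simp add: module_hom_iff module_axioms)
    next
      fix x u h assume u: "u \<in> comp h"
      obtain m where m: "unit_op j x m" using ex_unit_op by metis
      then have "unit_op j (u * x) (\<lambda>z. u * m z)" "unit_op j (x * u) (\<lambda>z. m z * u)"
        using u by (auto simp: unit_op_def intro: mult_ops_mult_left mult_ops_mult_right)
      with m show "T j (u * x) = u * T j x" "T j (x * u) = T j x * u"
        by (simp_all add: T_eq)
    next
      fix x h
      obtain m where m: "unit_op j x m" using ex_unit_op by metis
      obtain m' where m': "m' \<in> mult_ops" "\<forall>x\<in>comp g. m' x = part h (m x)"
        using mult_ops_part m unit_op_def by metis
      with m insert.prems have "unit_op j (part h x) m'"
        by (auto simp: unit_op_def)
      with m m' insert.prems show "T j (part h x) = part h (T j x)"
        by (simp add: T_eq)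
    qed
    then obtain c where c: "\<And>j y. T j y = c j *s y" by metis
    \<comment> \<open>Every operator in \<open>mult_ops\<close> vanishes at \<open>a0\<close>,
      because its value at \<open>a k\<close> is the sum of the contributions
      \<open>c j *s m (a j)\<close>. Hence \<open>a0 = 0\<close>, which contradicts
      independence.\<close>
    define a0 where "a0 = a k - (\<Sum>j\<in>J. c j *s a j)"
    have m_a0: "m a0 = 0" if m: "m \<in> mult_ops" for m
    proof -
      have "\<forall>j. \<exists>m'. unit_op j (m (a j)) m'" using ex_unit_op by blast
      then obtain m' where m': "\<And>j. unit_op j (m (a j)) (m' j)"
        unfolding choice_iff by blast
      have "m (a k) = (\<Sum>j\<in>J. m' j (a k))"
      proof (rule determined[of m "\<lambda>x. \<Sum>j\<in>J. m' j x", OF m mult_ops_sum])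
        fix i assume "i \<in> J"
        then show "m (a i) = (\<Sum>j\<in>J. m' j (a i))"
          using m' insert.hyps by (simp add: unit_op_def)
      qed (use m' unit_op_def in auto)
      also have "\<dots> = (\<Sum>j\<in>J. c j *s m (a j))"
        by (intro sum.cong refl) (metis T_eq m' c)
      finally show ?thesis
        using module_hom_mult_ops[OF m]
        by (simp add: a0_def module_hom.diff module_hom.sum module_hom.scale)
    qed
    have "a0 = 0"
    proof (rule sandwich_trivial)
      fix h h' u v assume "u \<in> comp h" "v \<in> comp h'"
      from m_a0[OF mult_ops.step[OF mult_ops.zero this]] show "u * a0 * v = 0" by simp
    qed
    moreover have "(\<Sum>i\<in>J. (if i = k then 1 else - c i) *s a i) = - (\<Sum>j\<in>J. c j *s a j)"
      unfolding sum_negf[symmetric] using insert.hyps by (intro sum.cong) auto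
    ultimately have "(\<Sum>i\<in>insert k J. (if i = k then 1 else - c i) *s a i) = 0"
      using insert.hyps by (simp add: a0_def)
    from lin_indepD[OF insert.prems(2) this, where i = k] show ?thesis by simp
  qed
qed

end

section \<open>Graded Capelli sums and block traces\<close>

text \<open>Multilinear extension: \<open>B\<close> singles out generators, \<open>C\<close> the
  admissible arguments, and the coordinates are released from \<open>B\<close> to \<open>C\<close>
  one at a time.\<close>

lemma coordinatewise_induct:
  fixes x :: "nat \<Rightarrow> 'x"
  assumes base: "\<And>x. (\<And>i. i < n \<Longrightarrow> B i (x i)) \<Longrightarrow> P x"
    and step: "\<And>x i y. i < n \<Longrightarrow> C i y \<Longrightarrow> (\<And>b. B i b \<Longrightarrow> P (x(i := b))) \<Longrightarrow> P (x(i := y))"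
    and x: "\<And>i. i < n \<Longrightarrow> C i (x i)"
  shows "P x"
proof -
  have "P x" if "k \<le> n" "\<And>i. i < k \<Longrightarrow> C i (x i)" "\<And>i. k \<le> i \<Longrightarrow> i < n \<Longrightarrow> B i (x i)" for k x
    using that
  proof (induction k arbitrary: x)
    case 0
    then show ?case by (intro base) auto
  next
    case (Suc k)
    have "P (x(k := b))" if "B k b" for b
    proof (rule Suc.IH)
      show "C i ((x(k := b)) i)" if "i < k" for i using that Suc.prems by simp
      show "B i ((x(k := b)) i)" if "k \<le> i" "i < n" for i
        using that Suc.prems(3)[of i] \<open>B k b\<close> by (cases "i = k") auto
    qed (use Suc.prems in auto)
    from step[of k "x k" x, OF _ _ this] Suc.prems show ?case by simp
  qed
  from this[of n x] x show ?thesis by simp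
qed

text \<open>
  Only permutations within each degree: the sum over all permutations would vanish identically on, for instance,
  a commutative algebra of dimension at least 2, such as the group algebra of a finite commutative group.
\<close>

definition deg_perms :: "nat \<Rightarrow> (nat \<Rightarrow> 'g) \<Rightarrow> (nat \<Rightarrow> nat) set" where
  "deg_perms n d = {p. p permutes {..<n} \<and> (\<forall>i. d (p i) = d i)}"

lemma finite_deg_perms: "finite (deg_perms n d)"
  unfolding deg_perms_def by (rule finite_subset[OF _ finite_permutations[of "{..<n}"]]) auto

lemma deg_permsD:
  assumes "p \<in> deg_perms n d"
  shows "p permutes {..<n}" "d (p i) = d i" "permutation p"
  using assms permutation_permutes by (auto simp: deg_perms_def)

lemma transpose_comp_deg_perms:
  assumes "p \<in> deg_perms n d" "a < n" "b < n" "d a = d b"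
  shows "Transposition.transpose a b \<circ> p \<in> deg_perms n d"
proof -
  have "Transposition.transpose a b \<circ> p permutes {..<n}"
    using assms by (intro permutes_compose permutes_swap_id deg_permsD) auto
  moreover have "d (Transposition.transpose a b i) = d i" for i
    using assms by (simp add: transpose_def)
  ultimately show ?thesis
    using assms by (simp add: deg_perms_def)
qed

section \<open>Alternating sums\<close>

context assoc_algebra
begin

lemma module_hom_wprod:
  assumes "distinct ks" "k \<in> set ks"
  shows "module_hom (*s) (*s) (\<lambda>y. wprod (map (h(k := y)) ks))"
  using assms
proof (induction ks)
  case (Cons j ks)
  show ?case
  proof (cases "j = k")
    case True
    with Cons.prems have "wprod (map (h(k := y)) (j # ks)) = (if ks = [] then y else y * wprod (map h ks))" for y
      by (auto simp: wprod_Cons intro!: arg_cong[where f = wprod] arg_cong[where f = "\<lambda>z. _ * z"])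
    then show ?thesis
      by (cases "ks = []") (simp_all only: if_True if_False simp_thms module_hom_id module_hom_mult_right)
  next
    case False
    with Cons have hom: "module_hom (*s) (*s) (\<lambda>y. wprod (map (h(k := y)) ks))" and "ks \<noteq> []"
      by (auto simp del: fun_upd_apply)
    then have eq: "wprod (map (h(k := y)) (j # ks)) = h j * wprod (map (h(k := y)) ks)" for y
      using False by (simp add: wprod_Cons)
    show ?thesis
      unfolding eq by (rule module_hom_comp[OF module_hom_mult_left hom])
  qed
qed simp

text \<open>The Capelli sum with an arbitrary operator \<open>m k\<close> at position
  \<open>k\<close>; \<open>m k y = u k * y * v k\<close> gives the values of the Capelli polynomial.
  General operators let density be applied at each position.\<close>

definition altsum :: "nat \<Rightarrow> (nat \<Rightarrow> 'g) \<Rightarrow> (nat \<Rightarrow> 'a \<Rightarrow> 'a) \<Rightarrow> (nat \<Rightarrow> 'a) \<Rightarrow> 'a" where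
  "altsum n d m x = (\<Sum>p\<in>deg_perms n d. of_int (sign p) *s wprod (map (\<lambda>k. m k (x (p k))) [0..<n]))"

lemma altsum_cong:
  assumes "\<And>i. i < n \<Longrightarrow> x i = y i" shows "altsum n d m x = altsum n d m y"
proof -
  have "p k < n" if "p \<in> deg_perms n d" "k < n" for p k
    using permutes_in_image[OF deg_permsD(1)[OF that(1)], of k] that(2) by simp
  then show ?thesis
    unfolding altsum_def using assms
    by (intro sum.cong refl arg_cong[where f = wprod] arg_cong2[where f = "(*s)"] map_cong) auto
qed

lemma module_hom_altsum:
  assumes m: "\<And>k. k < n \<Longrightarrow> module_hom (*s) (*s) (m k)" and i: "i < n"
  shows "module_hom (*s) (*s) (\<lambda>y. altsum n d m (x(i := y)))"
  unfolding altsum_def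
proof (intro module_hom_sum module_hom_scaled)
  fix p assume "p \<in> deg_perms n d"
  then have p: "p permutes {..<n}" by (rule deg_permsD)
  define k where "k = inv p i"
  have k: "k < n" "p k = i"
    using i permutes_in_image[OF permutes_inv[OF p], of i] permutes_inverses(1)[OF p] by (auto simp: k_def)
  define h where "h j = m j (x (p j))" for j
  have "p j = i \<longleftrightarrow> j = k" for j
    using permutes_inj[OF p] k by (auto dest: injD)
  then have eq: "map (\<lambda>j. m j ((x(i := y)) (p j))) [0..<n] = map (h(k := m k y)) [0..<n]" for y
    by (auto simp: h_def k)
  show "module_hom (*s) (*s) (\<lambda>y. wprod (map (\<lambda>j. m j ((x(i := y)) (p j))) [0..<n]))"
    unfolding eq by (rule module_hom_comp[OF module_hom_wprod m[OF k(1)]]) (use k in auto)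
qed

text \<open>Linearity in the operator at position \<open>k\<close>: the maps
  \<open>\<Lambda> p\<close> do not depend on \<open>f\<close>.\<close>

lemma altsum_op:
  assumes k: "k < n"
  obtains \<Lambda> where "\<And>f. altsum n d (m(k := f)) x = (\<Sum>p\<in>deg_perms n d. \<Lambda> p (f (x (p k))))"
    "\<And>p. module_hom (*s) (*s) (\<Lambda> p)"
proof
  define h where "h p j = m j (x (p j))" for p and j :: nat
  show "altsum n d (m(k := f)) x = (\<Sum>p\<in>deg_perms n d.
      of_int (sign p) *s wprod (map ((h p)(k := f (x (p k)))) [0..<n]))" for f
    unfolding altsum_def
    by (intro sum.cong refl arg_cong[where f = wprod] arg_cong2[where f = "(*s)"] map_cong) (auto simp: h_def)
  show "module_hom (*s) (*s) (\<lambda>y. of_int (sign p) *s wprod (map ((h p)(k := y)) [0..<n]))" for p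
    by (intro module_hom_scaled module_hom_wprod) (use k in auto)
qed

text \<open>Composition with the transposition of \<open>a\<close> and \<open>b\<close> permutes the
  summands, leaves their products unchanged and reverses their signs, so the sum equals its
  negative. Equality of the degrees keeps the composed permutations in
  \<open>deg_perms\<close>.\<close>

lemma altsum_alternating:
  fixes d :: "nat \<Rightarrow> 'g"
  assumes ab: "a < n" "b < n" "a \<noteq> b" "d a = d b" "x a = x b"
    and char: "(2 :: 'f) \<noteq> 0"
  shows "altsum n d m x = 0"
proof -
  let ?t = "Transposition.transpose a b"
  have x: "x (?t i) = x i" for i
    using ab by (simp add: transpose_def)
  have tt: "?t \<circ> (?t \<circ> p) = p" for p
    by (simp add: fun_eq_iff)
  have "altsum n d m x = (\<Sum>p\<in>deg_perms n d. of_int (sign (?t \<circ> p)) *s wprod (map (\<lambda>k. m k (x ((?t \<circ> p) k))) [0..<n]))"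
    unfolding altsum_def using ab
    by (intro sum.reindex_bij_witness[of _ "\<lambda>p. ?t \<circ> p" "\<lambda>p. ?t \<circ> p"])
      (auto simp: transpose_comp_deg_perms tt)
  also have "\<dots> = (\<Sum>p\<in>deg_perms n d. - (of_int (sign p) *s wprod (map (\<lambda>k. m k (x (p k))) [0..<n])))"
    using ab by (intro sum.cong refl)
      (simp add: x sign_compose permutation_swap_id sign_swap_id deg_permsD)
  also have "\<dots> = - altsum n d m x"
    by (simp add: altsum_def sum_negf)
  finally have "2 *s altsum n d m x = 0"
    by (metis add.right_inverse mult_2 scale_left_distrib scale_one one_add_one)
  with char show ?thesis by simp
qed

end

context graded_algebra
begin

text \<open>Insert a linear relation at argument \<open>a\<close>: terms with another
  \<open>x i\<close> have a repeated argument and vanish, leaving \<open>c a\<close> times a nonzero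
  value.\<close>

lemma lin_indep_if_altsum_nonzero:
  assumes m: "\<And>k. k < n \<Longrightarrow> module_hom (*s) (*s) (m k)"
    and x: "\<And>i. i < n \<Longrightarrow> x i \<in> comp (d i)"
    and nz: "altsum n d m x \<noteq> 0"
    and char: "(2 :: 'f) \<noteq> 0"
  shows "lin_indep {..<n} x"
  unfolding lin_indep_def
proof (intro allI impI ballI)
  fix c a assume sum: "(\<Sum>i<n. c i *s x i) = 0" and a: "a \<in> {..<n}"
  \<comment> \<open>The sum alternates only within a degree, so the relation is first projected to
    the degree of \<open>x a\<close>.\<close>
  have "(\<Sum>i<n. (if d i = d a then c i else 0) *s x i) = part (d a) (\<Sum>i<n. c i *s x i)"
    unfolding part_sum part_scale by (intro sum.cong refl) (auto simp: part_of_homogeneous[OF x])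
  also have "\<dots> = 0" by (simp add: sum)
  finally have 0: "(\<Sum>i<n. (if d i = d a then c i else 0) *s x i) = 0" .
  have mh: "module_hom (*s) (*s) (\<lambda>y. altsum n d m (x(a := y)))"
    using a by (intro module_hom_altsum m) auto
  have "0 = altsum n d m (x(a := \<Sum>i<n. (if d i = d a then c i else 0) *s x i))"
    using module_hom.zero[OF mh] 0 by simp
  also have "\<dots> = (\<Sum>i<n. (if d i = d a then c i else 0) *s altsum n d m (x(a := x i)))"
    by (rule module_hom_expand[OF mh])
  also have "\<dots> = (\<Sum>i<n. if i = a then c a *s altsum n d m x else 0)"
  proof (intro sum.cong refl)
    fix i assume i: "i \<in> {..<n}"
    show "(if d i = d a then c i else 0) *s altsum n d m (x(a := x i)) = (if i = a then c a *s altsum n d m x else 0)"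
      using i a altsum_alternating[of a n i d "x(a := x i)" m] char by (cases "i = a") auto
  qed
  also have "\<dots> = c a *s altsum n d m x"
    using a by simp
  finally show "c a = 0" using nz by simp
qed

definition hom_indep :: "nat \<Rightarrow> (nat \<Rightarrow> 'g) \<Rightarrow> (nat \<Rightarrow> 'a) \<Rightarrow> bool" where
  "hom_indep n d x \<longleftrightarrow> (\<forall>i<n. x i \<in> comp (d i)) \<and> lin_indep {..<n} x"

lemma span_if_maximal:
  assumes x: "hom_indep n d x" and max: "\<And>m d' x'. hom_indep m d' x' \<Longrightarrow> m \<le> n"
  shows "\<exists>c. y = (\<Sum>i<n. c i *s x i)"
proof -
  let ?S = "{y. \<exists>c. y = (\<Sum>i<n. c i *s x i)}"
  have "y \<in> ?S" if y: "y \<in> comp g" for y g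
  proof (rule ccontr)
    assume nin: "y \<notin> ?S"
    have "lin_indep {..<Suc n} (x(n := y))"
      unfolding lin_indep_def
    proof (intro allI impI)
      fix c assume "(\<Sum>i<Suc n. c i *s (x(n := y)) i) = 0"
      then have sum: "(\<Sum>i<n. c i *s x i) + c n *s y = 0" by simp
      have "c n = 0"
      proof (rule ccontr)
        assume "c n \<noteq> 0"
        have "c n *s y = - (\<Sum>i<n. c i *s x i)"
          using sum by (simp add: eq_neg_iff_add_eq_0 add.commute)
        then have "inverse (c n) *s (c n *s y) = inverse (c n) *s (- (\<Sum>i<n. c i *s x i))"
          by simp
        then have "y = (\<Sum>i<n. (- inverse (c n) * c i) *s x i)"
          using \<open>c n \<noteq> 0\<close> by (simp add: scale_sum_right sum_negf)
        then have "y \<in> ?S"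
          by (intro CollectI exI)
        then show False using nin by contradiction
      qed
      with sum have "(\<Sum>i<n. c i *s x i) = 0" by simp
      then have "\<forall>i<n. c i = 0"
        using x lin_indepD[of "{..<n}" x c] by (auto simp: hom_indep_def)
      with \<open>c n = 0\<close> show "\<forall>i\<in>{..<Suc n}. c i = 0" by (auto simp: less_Suc_eq)
    qed
    then have "hom_indep (Suc n) (d(n := g)) (x(n := y))"
      using x y by (auto simp: hom_indep_def less_Suc_eq)
    from max[OF this] show False by simp
  qed
  moreover have "subspace ?S"
    unfolding subspace_def
  proof (intro conjI ballI allI)
    show "0 \<in> ?S" by (auto intro: exI[of _ "\<lambda>i. 0"])
  next
    fix y z assume "y \<in> ?S" "z \<in> ?S"
    then obtain b c where "y = (\<Sum>i<n. b i *s x i)" "z = (\<Sum>i<n. c i *s x i)" by blast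
    then show "y + z \<in> ?S"
      by (auto intro!: exI[of _ "\<lambda>i. b i + c i"] simp: scale_left_distrib sum.distrib)
  next
    fix c y assume "y \<in> ?S"
    then obtain b where "y = (\<Sum>i<n. b i *s x i)" by blast
    then show "c *s y \<in> ?S"
      by (auto intro!: exI[of _ "\<lambda>i. c * b i"] simp: scale_sum_right)
  qed
  ultimately have "(\<Sum>g | part g y \<noteq> 0. part g y) \<in> ?S"
    by (intro subspace_sum) (use part_in in blast)+
  then show ?thesis by (simp add: sum_part)
qed

lemma hom_indep_bound:
  assumes "\<exists>basis. finite_dimensional_vector_space (*s) basis"
  shows "\<exists>N. \<forall>n d x. hom_indep n d x \<longrightarrow> n \<le> N"
proof -
  obtain basis where fd: "finite_dimensional_vector_space (*s) basis" using assms by blast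
  have "n \<le> card basis" if "hom_indep n d x" for n d x
    using card_le_if_lin_indep[OF _ _ fd, of "{..<n}" x] that by (simp add: hom_indep_def)
  then show ?thesis by blast
qed

lemma maximal_hom_indep:
  assumes "\<exists>basis. finite_dimensional_vector_space (*s) basis"
  obtains n d x where "hom_indep n d x" "\<And>m d' x'. hom_indep m d' x' \<Longrightarrow> m \<le> n"
proof -
  obtain N where N: "\<And>n d x. hom_indep n d x \<Longrightarrow> n \<le> N"
    using hom_indep_bound[OF assms] by blast
  let ?P = "\<lambda>n. \<exists>d x. hom_indep n d x"
  have "hom_indep 0 (\<lambda>_. 0) (\<lambda>_. 0)" by (simp add: hom_indep_def lin_indep_def)
  then have "?P (Greatest ?P)"
    by (intro GreatestI_nat[of ?P 0 N]) (use N in blast)+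
  moreover have "m \<le> Greatest ?P" if "hom_indep m d' x'" for m d' x'
    using that N by (intro Greatest_le_nat[of ?P m N]) blast+
  ultimately show ?thesis using that by blast
qed

end

section \<open>Coordinates in a homogeneous basis and block traces\<close>

locale based_graded_algebra = graded_algebra scale comp
  for scale :: "'f::field_char_0 \<Rightarrow> 'a::ring \<Rightarrow> 'a" (infixr \<open>*s\<close> 75)
    and comp :: "'g::group_add \<Rightarrow> 'a set" +
  fixes n :: nat and d :: "nat \<Rightarrow> 'g" and e :: "nat \<Rightarrow> 'a"
  assumes e_homogeneous: "i < n \<Longrightarrow> e i \<in> comp (d i)"
    and e_indep: "lin_indep {..<n} e"
    and e_span: "\<exists>c. x = (\<Sum>i<n. c i *s e i)"
begin

definition coord :: "'a \<Rightarrow> nat \<Rightarrow> 'f" where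
  "coord x = (SOME c. x = (\<Sum>i<n. c i *s e i))"

lemma coord_sum: "(\<Sum>i<n. coord x i *s e i) = x"
  using someI_ex[OF e_span[of x]] by (simp add: coord_def)

lemma coord_unique:
  assumes "(\<Sum>i<n. c i *s e i) = x" "i < n" shows "coord x i = c i"
proof -
  have "(\<Sum>i<n. (coord x i - c i) *s e i) = 0"
    by (simp add: scale_left_diff_distrib sum_subtractf coord_sum assms)
  from lin_indepD[OF e_indep this, of i] assms show ?thesis by simp
qed

lemma coord_add: "i < n \<Longrightarrow> coord (x + y) i = coord x i + coord y i"
  by (rule coord_unique) (simp_all add: scale_left_distrib sum.distrib coord_sum)

lemma coord_scale: "i < n \<Longrightarrow> coord (c *s x) i = c * coord x i"
  by (rule coord_unique) (simp_all add: coord_sum flip: scale_scale scale_sum_right)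

lemma coord_0 [simp]: "i < n \<Longrightarrow> coord 0 i = 0"
  using coord_scale[of i 0 0] by simp

lemma coord_sum_distrib: "i < n \<Longrightarrow> coord (\<Sum>j\<in>J. f j) i = (\<Sum>j\<in>J. coord (f j) i)"
  by (induction J rule: infinite_finite_induct) (auto simp: coord_add)

lemma coord_basis: "i < n \<Longrightarrow> j < n \<Longrightarrow> coord (e j) i = (if i = j then 1 else 0)"
  by (rule coord_unique) (simp_all add: if_distrib[of "\<lambda>c. c *s _"] cong: if_cong)

lemma eq_if_coord_eq: "(\<And>i. i < n \<Longrightarrow> coord x i = coord y i) \<Longrightarrow> x = y"
  using coord_sum[of x] coord_sum[of y] by (metis (no_types, lifting) lessThan_iff sum.cong)

lemma coord_homogeneous:
  assumes "x \<in> comp g" "i < n" "d i \<noteq> g" shows "coord x i = 0"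
proof -
  have "part g (\<Sum>i<n. coord x i *s e i) = (\<Sum>i<n. (if d i = g then coord x i else 0) *s e i)"
    unfolding part_sum part_scale
    by (intro sum.cong refl) (auto simp: part_of_homogeneous[OF e_homogeneous])
  then have "(\<Sum>i<n. (if d i = g then coord x i else 0) *s e i) = x"
    by (simp add: coord_sum part_of_homogeneous[OF assms(1)])
  from coord_unique[OF this assms(2)] assms(3) show ?thesis by simp
qed

text \<open>The trace of \<open>T\<close> compressed to the component of degree \<open>g\<close>; it vanishes if \<open>T\<close> maps this component to another one.\<close>

definition btrace :: "'g \<Rightarrow> ('a \<Rightarrow> 'a) \<Rightarrow> 'f" where
  "btrace g T = (\<Sum>i | i < n \<and> d i = g. coord (T (e i)) i)"

lemma btrace_add: "btrace g (\<lambda>x. S x + T x) = btrace g S + btrace g T"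
  by (simp add: btrace_def coord_add sum.distrib)

lemma btrace_scale: "btrace g (\<lambda>x. c *s T x) = c * btrace g T"
  by (simp add: btrace_def coord_scale sum_distrib_left)

lemma btrace_sum: "btrace g (\<lambda>x. \<Sum>i\<in>I. T i x) = (\<Sum>i\<in>I. btrace g (T i))"
  by (simp add: btrace_def coord_sum_distrib sum.swap[of _ I])

text \<open>Both sides are multilinear in \<open>x\<close>, so \<open>x i\<close> may be taken among
  the basis vectors of degree \<open>d i\<close>. If these form a permutation of the basis, only the
  diagonal coefficients of \<open>T\<close> survive and add up to the trace; if two of them
  coincide, both sides are zero.\<close>

lemma altsum_trace:
  assumes m: "\<And>k. k < n \<Longrightarrow> module_hom (*s) (*s) (m k)"
    and T: "module_hom (*s) (*s) T" "\<And>x. x \<in> comp g \<Longrightarrow> T x \<in> comp g"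
    and x: "\<And>i. i < n \<Longrightarrow> x i \<in> comp (d i)"
  shows "(\<Sum>i | i < n \<and> d i = g. altsum n d m (x(i := T (x i)))) = btrace g T *s altsum n d m x"
    (is "?F x = ?G x")
proof (rule coordinatewise_induct[where B = "\<lambda>i y. \<exists>j<n. d j = d i \<and> y = e j" and C = "\<lambda>i y. y \<in> comp (d i)"
      and P = "\<lambda>x. ?F x = ?G x", OF _ _ x])
  fix x i y
  assume i: "i < n" and y: "y \<in> comp (d i)" and IH: "\<And>b. \<exists>j<n. d j = d i \<and> b = e j \<Longrightarrow> ?F (x(i := b)) = ?G (x(i := b))"
  \<comment> \<open>Only basis vectors of degree \<open>d i\<close> occur, and these are the ones
    covered by \<open>IH\<close>.\<close>
  have y_sum: "y = (\<Sum>j | j < n \<and> d j = d i. coord y j *s e j)"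
    by (subst (1) coord_sum[of y, symmetric], intro sum.mono_neutral_right) (auto simp: coord_homogeneous[OF y])
  have alt: "module_hom (*s) (*s) (\<lambda>z. altsum n d m (x(j := z)))" if "j < n" for x j
    by (intro module_hom_altsum m that)
  have "module_hom (*s) (*s) (\<lambda>z. ?F (x(i := z)))"
  proof (intro module_hom_sum)
    fix j assume "j \<in> {j. j < n \<and> d j = g}"
    then have j: "j < n" by simp
    show "module_hom (*s) (*s) (\<lambda>z. altsum n d m ((x(i := z))(j := T ((x(i := z)) j))))"
    proof (cases "j = i")
      case True
      then show ?thesis using module_hom_comp[OF alt[OF i, of x] T(1)] by simp
    next
      case False
      then show ?thesis using alt[OF i, of "x(j := T (x j))"] by (simp add: fun_upd_twist)
    qed
  qed
  from module_hom_expand[OF this, of "coord y" e "{j. j < n \<and> d j = d i}"] have F: "?F (x(i := y)) = (\<Sum>j | j < n \<and> d j = d i. coord y j *s ?F (x(i := e j)))"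
    by (simp only: y_sum[symmetric])
  have "module_hom (*s) (*s) (\<lambda>z. ?G (x(i := z)))"
    by (intro module_hom_scaled alt i)
  from module_hom_expand[OF this, of "coord y" e "{j. j < n \<and> d j = d i}"] have G: "?G (x(i := y)) = (\<Sum>j | j < n \<and> d j = d i. coord y j *s ?G (x(i := e j)))"
    by (simp only: y_sum[symmetric])
  show "?F (x(i := y)) = ?G (x(i := y))"
    unfolding F G by (intro sum.cong refl arg_cong2[where f = "(*s)"] IH) auto
next
  fix x assume "\<And>i. i < n \<Longrightarrow> \<exists>j<n. d j = d i \<and> x i = e j"
  then obtain q where q: "\<And>i. i < n \<Longrightarrow> q i < n \<and> d (q i) = d i \<and> x i = e (q i)" by metis
  have alt: "module_hom (*s) (*s) (\<lambda>z. altsum n d m (x(j := z)))" if "j < n" for x j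
    by (intro module_hom_altsum m that)
  have alt0: "altsum n d m x = 0" if "a < n" "b < n" "a \<noteq> b" "d a = d b" "x a = x b" for x a b
    by (rule altsum_alternating[OF that]) simp
  show "?F x = ?G x"
  proof (cases "inj_on q {..<n}")
    case True
    have bij: "q ` {..<n} = {..<n}"
      using True q by (intro card_subset_eq) (auto simp: card_image)
    let ?I = "{i. i < n \<and> d i = g}"
    have "bij_betw q ?I ?I"
    proof (rule bij_betw_imageI)
      show "inj_on q ?I" by (rule inj_on_subset[OF True]) auto
      show "q ` ?I = ?I"
      proof (intro equalityI subsetI)
        fix j assume j: "j \<in> ?I"
        then obtain i where "i < n" "j = q i" using bij by blast
        with j q show "j \<in> q ` ?I" by auto
      qed (use q in auto)
    qed
    \<comment> \<open>Expand \<open>T (x i)\<close> in the basis: a vector of degree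
      \<open>g\<close> other than \<open>x i\<close> already occupies another argument, and vectors
      of other degrees have coefficient zero.\<close>
    have tm: "altsum n d m (x(i := T (x i))) = coord (T (e (q i))) (q i) *s altsum n d m x" if i: "i \<in> ?I" for i
    proof -
      have Tq: "T (e (q i)) \<in> comp g"
        using T(2) e_homogeneous[of "q i"] q i by auto
      have "altsum n d m (x(i := T (x i))) = altsum n d m (x(i := \<Sum>j<n. coord (T (e (q i))) j *s e j))"
        using q i by (simp add: coord_sum)
      also have "\<dots> = (\<Sum>j<n. coord (T (e (q i))) j *s altsum n d m (x(i := e j)))"
        using i by (intro module_hom_expand[OF alt]) auto
      also have "\<dots> = (\<Sum>j<n. if j = q i then coord (T (e (q i))) (q i) *s altsum n d m x else 0)"
      proof (intro sum.cong refl)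
        fix j assume j: "j \<in> {..<n}"
        show "coord (T (e (q i))) j *s altsum n d m (x(i := e j)) =
          (if j = q i then coord (T (e (q i))) (q i) *s altsum n d m x else 0)"
        proof (cases "j = q i")
          case True
          moreover have "x(i := e (q i)) = x" using q i by (auto simp: fun_eq_iff)
          ultimately show ?thesis by simp
        next
          case jq: False
          show ?thesis
          proof (cases "d j = g")
            case True
            from bij j obtain k where k: "k < n" "j = q k" by blast
            with jq have "k \<noteq> i" by auto
            have "altsum n d m (x(i := e j)) = 0"
              using i k \<open>k \<noteq> i\<close> True q by (intro alt0[of i k]) auto
            with jq show ?thesis by simp
          next
            case False
            with coord_homogeneous[OF Tq] j jq show ?thesis by simp
          qed
        qed
      qed
      finally show ?thesis using q i by simp
    qed
    have "?F x = (\<Sum>i\<in>?I. coord (T (e (q i))) (q i)) *s altsum n d m x"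
      unfolding scale_sum_left by (intro sum.cong refl tm)
    also have "(\<Sum>i\<in>?I. coord (T (e (q i))) (q i)) = btrace g T"
      unfolding btrace_def by (rule sum.reindex_bij_betw[OF \<open>bij_betw q ?I ?I\<close>])
    finally show ?thesis .
  next
    case False
    then obtain a b where ab: "a < n" "b < n" "a \<noteq> b" "q a = q b"
      by (auto simp: inj_on_def)
    then have xab: "x a = x b" "d a = d b" using q[of a] q[of b] by auto
    define w where "w = T (x a)"
    \<comment> \<open>Antisymmetry by polarization: the value at the repeated argument
      \<open>u + v\<close> vanishes. The two summands of \<open>?F x\<close> not killed by
      \<open>x a = x b\<close> therefore cancel.\<close>
    have swap: "altsum n d m (x(a := w)) + altsum n d m (x(b := w)) = 0"
    proof -
      let ?f = "\<lambda>u v. altsum n d m (x(a := u, b := v))"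
      have 1: "?f (u + u') v = ?f u v + ?f u' v" for u u' v
        using module_hom.add[OF alt[of a "x(b := v)"]] ab by (simp add: fun_upd_twist)
      have 2: "?f u (v + v') = ?f u v + ?f u v'" for u v v'
        using module_hom.add[OF alt[of b "x(a := u)"]] ab by simp
      have "?f u u = 0" for u
        using ab xab by (intro alt0[of a b]) auto
      from this[of "u + v" for u v] this have "?f u v + ?f v u = 0" for u v
        unfolding 1 2 by (simp add: add.commute)
      note this[of "x a" w]
      moreover have "x(a := x a, b := w) = x(b := w)" "x(a := w, b := x a) = x(a := w)"
        using ab xab by (auto simp: fun_eq_iff)
      ultimately show ?thesis by (simp add: add.commute)
    qed
    have other: "altsum n d m (x(i := T (x i))) = 0" if "i \<noteq> a" "i \<noteq> b" for i
      using that ab xab by (intro alt0[of a b]) auto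
    have "?F x = 0"
    proof (cases "d a = g")
      case True
      have "?F x = (\<Sum>i\<in>{a, b}. altsum n d m (x(i := T (x i))))"
        using True ab xab by (intro sum.mono_neutral_right ballI other) auto
      also have "\<dots> = 0"
        using ab swap xab by (simp add: w_def)
      finally show ?thesis .
    next
      case False
      then show ?thesis using xab by (intro sum.neutral ballI other) auto
    qed
    moreover have "altsum n d m x = 0"
      by (rule alt0[of a b]) (use ab xab in auto)
    ultimately show ?thesis by simp
  qed
qed

end

locale based_simple_graded_algebra =
  nonnull_simple_graded_algebra scale comp + based_graded_algebra scale comp n d e
  for scale :: "'f::{alg_closed_field, field_char_0} \<Rightarrow> 'a::ring \<Rightarrow> 'a" (infixr \<open>*s\<close> 75)
    and comp :: "'g::group_add \<Rightarrow> 'a set" and n d e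

context nonnull_simple_graded_algebra
begin

text \<open>A nonzero product can be prolonged on the left, since no nonzero element is annihilated
  by all left factors.\<close>

lemma wprod_nonzero_exists: "n > 0 \<Longrightarrow> \<exists>b. wprod (map b [0..<n]) \<noteq> (0 :: 'a)"
proof -
  have "\<exists>w :: 'a list. length w = Suc k \<and> wprod w \<noteq> 0" for k
  proof (induction k)
    case 0
    obtain x y :: 'a where "x * y \<noteq> 0" using nonnull by blast
    then show ?case by (intro exI[of _ "[x]"]) auto
  next
    case (Suc k)
    then obtain w :: "'a list" where w: "length w = Suc k" "wprod w \<noteq> 0" by blast
    then obtain x where "x * wprod w \<noteq> 0" using right_annihilator_trivial by blast
    with w show ?case by (intro exI[of _ "x # w"]) (auto simp: wprod_Cons)
  qed
  moreover assume "n > 0"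
  ultimately obtain w :: "'a list" where "length w = n" "wprod w \<noteq> 0" by (metis Suc_pred)
  then show ?thesis
    by (intro exI[of _ "\<lambda>i. w ! i"]) (use map_nth[of w] in auto)
qed

text \<open>
  Density provides operators \<open>m k\<close> sending \<open>x k\<close> to \<open>b k\<close> and the other \<open>x i\<close> of the same degree to zero, so that only
  the identity permutation contributes; then expand the \<open>m k\<close> into two-sided multiplications.
\<close>

lemma altsum_nonzero_exists:
  fixes d :: "nat \<Rightarrow> 'g"
  assumes x: "hom_indep n d x" and n: "n > 0"
  shows "\<exists>h h' u v. (\<forall>k. u k \<in> comp (h k) \<and> v k \<in> comp (h' k)) \<and> altsum n d (\<lambda>k y. u k * y * v k) x \<noteq> 0"
proof (rule ccontr)
  assume none: "\<not> ?thesis"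
  \<comment> \<open>By \<open>none\<close> the sum vanishes for single two-sided multiplications;
    linearity in each operator extends this to all of \<open>mult_ops\<close>.\<close>
  have all0: "altsum n d m x = 0" if m: "\<And>k. k < n \<Longrightarrow> m k \<in> mult_ops" for m
  proof (rule coordinatewise_induct[where B = "\<lambda>k f. \<exists>h h'. \<exists>u\<in>comp h. \<exists>v\<in>comp h'. f = (\<lambda>y. u * y * v)"
        and C = "\<lambda>k f. f \<in> mult_ops" and P = "\<lambda>m. altsum n d m x = 0", OF _ _ m])
    fix m assume "\<And>k. k < n \<Longrightarrow> \<exists>h h'. \<exists>u\<in>comp h. \<exists>v\<in>comp h'. m k = (\<lambda>y. u * y * v)"
    then have "\<forall>k. \<exists>h h' u v. k < n \<longrightarrow> u \<in> comp h \<and> v \<in> comp h' \<and> m k = (\<lambda>y. u * y * v)" by blast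
    then obtain h h' u v where *: "\<And>k. k < n \<Longrightarrow> u k \<in> comp (h k) \<and> v k \<in> comp (h' k) \<and> m k = (\<lambda>y. u k * y * v k)"
      by metis
    \<comment> \<open>Positions from \<open>n\<close> on are filled with 0, because
      \<open>none\<close> speaks of coefficients that are homogeneous at every
      \<open>k\<close>.\<close>
    define u' v' where "u' k = (if k < n then u k else 0)" and "v' k = (if k < n then v k else 0)" for k
    have "altsum n d m x = altsum n d (\<lambda>k y. u' k * y * v' k) x"
      unfolding altsum_def
      by (intro sum.cong refl arg_cong[where f = wprod] arg_cong2[where f = "(*s)"] map_cong) (auto simp: * u'_def v'_def)
    also have "\<dots> = 0"
    proof -
      have "\<forall>k. u' k \<in> comp (h k) \<and> v' k \<in> comp (h' k)"
        using * by (simp add: u'_def v'_def comp_0)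
      then show ?thesis using none by blast
    qed
    finally show "altsum n d m x = 0" .
  next
    fix m k f
    assume k: "k < n" and f: "f \<in> mult_ops"
      and IH: "\<And>b. \<exists>h h'. \<exists>u\<in>comp h. \<exists>v\<in>comp h'. b = (\<lambda>y. u * y * v) \<Longrightarrow> altsum n d (m(k := b)) x = 0"
    obtain \<Lambda> where \<Lambda>: "\<And>f. altsum n d (m(k := f)) x = (\<Sum>p\<in>deg_perms n d. \<Lambda> p (f (x (p k))))"
      "\<And>p. module_hom (*s) (*s) (\<Lambda> p)"
      using altsum_op[OF k, of d m x] by blast
    from f show "altsum n d (m(k := f)) x = 0"
    proof (induction rule: mult_ops.induct)
      case zero
      show ?case unfolding \<Lambda>(1) by (simp add: module_hom.zero[OF \<Lambda>(2)])
    next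
      case (step f u h v h')
      have "altsum n d (m(k := \<lambda>y. u * y * v)) x = 0"
        using step by (intro IH) blast
      with step.IH show ?case
        unfolding \<Lambda>(1) by (simp add: module_hom.add[OF \<Lambda>(2)] sum.distrib)
    qed
  qed
  obtain b :: "nat \<Rightarrow> 'a" where b: "wprod (map b [0..<n]) \<noteq> 0"
    using wprod_nonzero_exists[OF n] by blast
  have "\<exists>m\<in>mult_ops. \<forall>i\<in>{i. i < n \<and> d i = d k}. m (x i) = (if i = k then b k else 0)" for k
  proof (rule density[where g = "d k"])
    show "lin_indep {i. i < n \<and> d i = d k} x"
      by (rule lin_indep_subset[of "{..<n}"]) (use x in \<open>auto simp: hom_indep_def\<close>)
  qed (use x in \<open>auto simp: hom_indep_def\<close>)
  then have "\<forall>k. \<exists>m. m \<in> mult_ops \<and> (\<forall>i. i < n \<longrightarrow> d i = d k \<longrightarrow> m (x i) = (if i = k then b k else 0))"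
    by blast
  then obtain m where m: "\<And>k. m k \<in> mult_ops"
    "\<And>k i. i < n \<Longrightarrow> d i = d k \<Longrightarrow> m k (x i) = (if i = k then b k else 0)"
    by metis
  have "altsum n d m x = (\<Sum>p\<in>deg_perms n d. if p = id then wprod (map b [0..<n]) else 0)"
    unfolding altsum_def
  proof (intro sum.cong refl)
    fix p assume p: "p \<in> deg_perms n d"
    note pD = deg_permsD[OF p]
    have mp: "m k (x (p k)) = (if p k = k then b k else 0)" if "k < n" for k
      using m(2)[of "p k" k] pD(2) permutes_in_image[OF pD(1)] that by auto
    show "of_int (sign p) *s wprod (map (\<lambda>k. m k (x (p k))) [0..<n]) = (if p = id then wprod (map b [0..<n]) else 0)"
    proof (cases "p = id")
      case True
      then have eq: "map (\<lambda>k. m k (x (p k))) [0..<n] = map b [0..<n]"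
        using mp by auto
      show ?thesis
        unfolding eq using True by (simp add: sign_id)
    next
      case False
      then obtain k where k: "p k \<noteq> k" by (auto simp: fun_eq_iff)
      then have "k < n" using permutes_not_in[OF pD(1), of k] by auto
      with mp k have "0 \<in> set (map (\<lambda>k. m k (x (p k))) [0..<n])" by force
      moreover have "wprod w = 0" if "0 \<in> set w" for w :: "'a list"
        using that by (induction w) (auto simp: wprod_Cons)
      ultimately show ?thesis using False by simp
    qed
  qed
  also have "id \<in> deg_perms n d" by (simp add: deg_perms_def permutes_id)
  then have "(\<Sum>p\<in>deg_perms n d. if p = id then wprod (map b [0..<n]) else 0) = wprod (map b [0..<n])"
    by (simp add: finite_deg_perms)
  finally show False using all0[of m] m(1) b by simp
qed

end

text \<open>If \<open>r * b\<close> has a nonzero coordinate at \<open>i\<close>, density gives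
  \<open>m\<close> in \<open>mult_ops\<close> sending \<open>e i\<close> to \<open>b\<close> and the
  other basis vectors of that degree to 0. The block trace of \<open>r * m x\<close> is then that
  coordinate, yet it is a sum of traces that vanish by assumption.\<close>

lemma (in based_simple_graded_algebra) btrace_nondegenerate:
  assumes r: "\<And>g h k u v. u \<in> comp h \<Longrightarrow> v \<in> comp k \<Longrightarrow> btrace g (\<lambda>x. r * (u * x * v)) = 0"
  shows "r = 0"
proof (rule left_annihilator_trivial, rule ccontr)
  fix b assume "r * b \<noteq> 0"
  then obtain i where i: "i < n" "coord (r * b) i \<noteq> 0"
    using eq_if_coord_eq[of "r * b" 0] by auto
  have "\<exists>m\<in>mult_ops. \<forall>j\<in>{j. j < n \<and> d j = d i}. m (e j) = (if j = i then b else 0)"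
  proof (rule density[where g = "d i"])
    show "lin_indep {j. j < n \<and> d j = d i} e"
      by (rule lin_indep_subset[OF e_indep]) auto
  qed (auto, metis e_homogeneous)
  then obtain m where m: "m \<in> mult_ops" "\<And>j. j < n \<Longrightarrow> d j = d i \<Longrightarrow> m (e j) = (if j = i then b else 0)"
    by blast
  have "btrace (d i) (\<lambda>x. r * m x) = 0"
    using m(1)
  proof (induction rule: mult_ops.induct)
    case zero
    show ?case by (simp add: btrace_def)
  next
    case (step m u h v k)
    then show ?case
      using r by (simp add: distrib_left btrace_add)
  qed
  moreover have "btrace (d i) (\<lambda>x. r * m x) = (\<Sum>j | j < n \<and> d j = d i. if j = i then coord (r * b) i else 0)"
    unfolding btrace_def by (intro sum.cong refl) (auto simp: m)
  ultimately show False using i by simp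
qed

section \<open>Trace polynomials\<close>

text \<open>\<open>TTrace g ws ws'\<close> stands for the trace, on the component of degree
  \<open>g\<close>, of multiplication by the word \<open>ws\<close> in the \<open>z\<close> on the
  left and \<open>ws'\<close> on the right. An empty list gives 0 rather than a unit, both in
  \<open>tval\<close> and in \<open>zword\<close>.\<close>

datatype ('g, 'f) trace_poly =
    TConst 'f
  | TTrace 'g "nat list" "nat list"
  | TAdd "('g, 'f) trace_poly" "('g, 'f) trace_poly"
  | TMult "('g, 'f) trace_poly" "('g, 'f) trace_poly"

text \<open>
  The residue of the index modulo 4 keeps the four families of variables disjoint: alternating variables \<open>x\<close>,
  trace variables \<open>z\<close>, and the left and right coefficients \<open>u\<close>, \<open>v\<close> of the Capelli polynomial.
\<close>

definition xvar :: "(nat \<Rightarrow> 'g) \<Rightarrow> nat \<Rightarrow> nat \<times> 'g" where "xvar d i = (4 * i, d i)"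
definition zvar :: "(nat \<Rightarrow> 'g) \<Rightarrow> nat \<Rightarrow> nat \<times> 'g" where "zvar d i = (4 * i + 1, d i)"
definition uvar :: "(nat \<Rightarrow> 'g) \<Rightarrow> nat \<Rightarrow> nat \<times> 'g" where "uvar h i = (4 * i + 2, h i)"
definition vvar :: "(nat \<Rightarrow> 'g) \<Rightarrow> nat \<Rightarrow> nat \<times> 'g" where "vvar h i = (4 * i + 3, h i)"

lemma var_eq_iff [simp]:
  "xvar d i = xvar d j \<longleftrightarrow> i = j" "zvar d i \<noteq> xvar d j" "uvar h i \<noteq> xvar d j" "vvar h i \<noteq> xvar d j"
  by (auto simp: xvar_def zvar_def uvar_def vvar_def, presburger+)

lemma fst_var_div_4 [simp]:
  "fst (xvar d i) div 4 = i" "fst (zvar d i) div 4 = i" "fst (uvar d i) div 4 = i" "fst (vvar d i) div 4 = i"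
  by (simp_all add: xvar_def zvar_def uvar_def vvar_def)

lemma var_neq [simp]:
  "vvar h i \<noteq> uvar d j" "xvar d i \<noteq> zvar h j" "uvar d i \<noteq> zvar h j" "vvar d i \<noteq> zvar h j"
  by (auto simp: xvar_def zvar_def uvar_def vvar_def, presburger+)

lemma graded_assignment_var:
  assumes "graded_assignment V \<phi>"
  shows "\<phi> (xvar d i) \<in> V (d i)" "\<phi> (zvar d i) \<in> V (d i)" "\<phi> (uvar d i) \<in> V (d i)" "\<phi> (vvar d i) \<in> V (d i)"
  using assms by (auto simp: graded_assignment_def xvar_def zvar_def uvar_def vvar_def)

lemma graded_assignment_upd:
  "graded_assignment V \<phi> \<Longrightarrow> y \<in> V (d i) \<Longrightarrow> graded_assignment V (\<phi>(xvar d i := y))"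
  by (auto simp: graded_assignment_def xvar_def)

definition zword :: "(nat \<Rightarrow> 'g) \<Rightarrow> nat list \<Rightarrow> ('g, 'f::field) graded_poly" where
  "zword d ws = wprod (map (\<lambda>j. pvar (zvar d j)) ws)"

definition degree_of :: "(nat \<Rightarrow> 'g::group_add) \<Rightarrow> nat list \<Rightarrow> 'g" where
  "degree_of d ws = sum_list (map d ws)"

definition capelli :: "nat \<Rightarrow> (nat \<Rightarrow> 'g) \<Rightarrow> (nat \<Rightarrow> 'g) \<Rightarrow> (nat \<Rightarrow> 'g) \<Rightarrow> ('g, 'f::field) graded_poly" where
  "capelli n d h h' = (\<Sum>p\<in>deg_perms n d. pscale (of_int (sign p))
    (wprod (map (\<lambda>k. pvar (uvar h k) * pvar (xvar d (p k)) * pvar (vvar h' k)) [0..<n])))"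

text \<open>
  \<open>trace_mult n d t P\<close> takes the value of \<open>t\<close> times that of \<open>P\<close>, provided \<open>P\<close> is a multiple of a Capelli polynomial.
\<close>

fun trace_mult :: "nat \<Rightarrow> (nat \<Rightarrow> 'g::group_add) \<Rightarrow> ('g, 'f::field) trace_poly \<Rightarrow>
    ('g, 'f) graded_poly \<Rightarrow> ('g, 'f) graded_poly" where
  "trace_mult n d (TConst c) P = pscale c P"
| "trace_mult n d (TTrace g ws ws') P =
    (if degree_of d ws + g + degree_of d ws' = g
     then \<Sum>i | i < n \<and> d i = g. psubst (pvar(xvar d i := zword d ws * pvar (xvar d i) * zword d ws')) P
     else 0)"
| "trace_mult n d (TAdd s t) P = trace_mult n d s P + trace_mult n d t P"
| "trace_mult n d (TMult s t) P = trace_mult n d s (trace_mult n d t P)"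

lemma const_free_zword: "const_free (zword d ws)"
  unfolding zword_def by (rule const_free_wprod) auto

lemma const_free_capelli: "const_free (capelli n d h h')"
  unfolding capelli_def
proof (rule const_free_sum)
  fix p
  show "const_free (pscale (of_int (sign p))
      (wprod (map (\<lambda>k. pvar (uvar h k) * pvar (xvar d (p k)) * pvar (vvar h' k)) [0..<n])))"
    unfolding lookup_pscale by (subst const_free_wprod) (auto intro!: const_free_mult)
qed

lemma const_free_trace_subst:
  "const_free ((pvar(xvar d i := zword d ws * pvar (xvar d i) * zword d ws')) y)"
  by (auto intro!: const_free_mult const_free_zword)

lemma const_free_trace_mult: "const_free P \<Longrightarrow> const_free (trace_mult n d t P)"
  by (induction t arbitrary: P)
    (auto simp: lookup_add intro!: const_free_sum const_free_psubst const_free_trace_subst simp del: fun_upd_apply)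

context assoc_algebra
begin

lemma pval_zword: "pval \<phi> (zword d ws) = wprod (map (\<lambda>j. \<phi> (zvar d j)) ws)"
  unfolding zword_def by (subst pval_wprod) (auto simp: o_def)

lemma pval_capelli:
  "pval \<phi> (capelli n d h h') = altsum n d (\<lambda>k y. \<phi> (uvar h k) * y * \<phi> (vvar h' k)) (\<lambda>i. \<phi> (xvar d i))"
proof -
  have "pval \<phi> (wprod (map (\<lambda>k. pvar (uvar h k) * pvar (xvar d (p k)) * pvar (vvar h' k)) [0..<n])) =
    wprod (map (\<lambda>k. \<phi> (uvar h k) * \<phi> (xvar d (p k)) * \<phi> (vvar h' k)) [0..<n])" for p
    by (subst pval_wprod) (auto simp: o_def pval_mult const_free_mult)
  then show ?thesis
    by (simp add: capelli_def altsum_def pval_sum pval_pscale)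
qed

end

context graded_algebra
begin

lemma wprod_homogeneous:
  assumes "\<And>i. z i \<in> comp (d i)" shows "wprod (map z ws) \<in> comp (degree_of d ws)"
proof (induction ws)
  case (Cons i ws)
  then show ?case
    using assms mult_comp[OF assms[of i] Cons] by (auto simp: wprod_Cons degree_of_def)
qed (simp add: comp_0)

end

context based_graded_algebra
begin

primrec tval :: "(nat \<Rightarrow> 'a) \<Rightarrow> ('g, 'f) trace_poly \<Rightarrow> 'f" where
  "tval z (TConst c) = c"
| "tval z (TTrace g ws ws') = btrace g (\<lambda>x. wprod (map z ws) * x * wprod (map z ws'))"
| "tval z (TAdd s t) = tval z s + tval z t"
| "tval z (TMult s t) = tval z s * tval z t"

text \<open>The property of Capelli polynomials on which multiplication by a trace rests.
  \<open>trace_mult\<close> preserves it, so trace factors can be iterated.\<close>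

definition traceable :: "('g, 'f) graded_poly \<Rightarrow> bool" where
  "traceable P \<longleftrightarrow> (\<forall>\<phi> g T. graded_assignment comp \<phi> \<longrightarrow> module_hom (*s) (*s) T \<longrightarrow>
    (\<forall>x\<in>comp g. T x \<in> comp g) \<longrightarrow>
    (\<Sum>i | i < n \<and> d i = g. pval (\<phi>(xvar d i := T (\<phi> (xvar d i)))) P) = btrace g T *s pval \<phi> P)"

lemma traceable_capelli: "traceable (capelli n d h h')"
  unfolding traceable_def
proof (intro allI impI)
  fix \<phi> g T
  assume \<phi>: "graded_assignment comp \<phi>" and T: "module_hom (*s) (*s) T" "\<forall>x\<in>comp g. T x \<in> comp g"
  let ?m = "\<lambda>k y. \<phi> (uvar h k) * y * \<phi> (vvar h' k)" and ?x = "\<lambda>i. \<phi> (xvar d i)"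
  have eq: "pval (\<phi>(xvar d i := y)) (capelli n d h h') = altsum n d ?m (?x(i := y))" for i y
  proof -
    have "(\<lambda>j. (\<phi>(xvar d i := y)) (xvar d j)) = ?x(i := y)" by (auto simp: fun_eq_iff)
    then show ?thesis
      by (simp only: pval_capelli fun_upd_apply var_eq_iff if_False)
  qed
  have "(\<Sum>i | i < n \<and> d i = g. altsum n d ?m (?x(i := T (?x i)))) = btrace g T *s altsum n d ?m ?x"
    by (rule altsum_trace)
      (use \<phi> T module_hom_comp[OF module_hom_mult_right module_hom_mult_left] in \<open>auto intro: graded_assignment_var\<close>)
  then show "(\<Sum>i | i < n \<and> d i = g. pval (\<phi>(xvar d i := T (\<phi> (xvar d i)))) (capelli n d h h')) =
    btrace g T *s pval \<phi> (capelli n d h h')"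
    unfolding eq unfolding pval_capelli .
qed

lemma btrace_eq_0:
  assumes "\<And>x. x \<in> comp g \<Longrightarrow> T x \<in> comp g'" "g \<noteq> g'" shows "btrace g T = 0"
  unfolding btrace_def
proof (intro sum.neutral ballI)
  fix i assume "i \<in> {i. i < n \<and> d i = g}"
  then show "coord (T (e i)) i = 0"
    using assms e_homogeneous[of i] by (intro coord_homogeneous[of _ g']) auto
qed

text \<open>The two claims need a joint induction: \<open>TMult\<close> applies the value formula to
  a polynomial that already carries a trace factor. It remains traceable because the factor depends
  only on the \<open>z\<close>-variables, while \<open>traceable\<close> changes only
  \<open>x\<close>-variables.\<close>

lemma pval_trace_mult:
  assumes "const_free P" "traceable P"
  shows "(\<forall>\<phi>. graded_assignment comp \<phi> \<longrightarrow>
      pval \<phi> (trace_mult n d t P) = tval (\<lambda>i. \<phi> (zvar d i)) t *s pval \<phi> P) \<and> traceable (trace_mult n d t P)"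
  using assms
proof (induction t arbitrary: P)
  case (TAdd s t)
  have *: "traceable (trace_mult n d s P + trace_mult n d t P)"
    using TAdd unfolding traceable_def by (auto simp: pval_add sum.distrib scale_right_distrib)
  with TAdd show ?case by (simp add: pval_add scale_left_distrib)
next
  case (TMult s t)
  then have "const_free (trace_mult n d t P)" by (simp add: const_free_trace_mult)
  with TMult show ?case by simp
next
  case (TConst c)
  then show ?case
    unfolding traceable_def
    by (auto simp: pval_pscale scale_left_commute simp flip: scale_sum_right)
next
  case (TTrace g ws ws')
  let ?Q = "trace_mult n d (TTrace g ws ws') P" and ?t = "TTrace g ws ws'"
  have main: "pval \<phi> ?Q = tval (\<lambda>i. \<phi> (zvar d i)) ?t *s pval \<phi> P" if \<phi>: "graded_assignment comp \<phi>" for \<phi>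
  proof -
    let ?z = "\<lambda>i. \<phi> (zvar d i)"
    define w w' where "w = wprod (map ?z ws)" and "w' = wprod (map ?z ws')"
    define T where "T x = w * x * w'" for x
    have w: "w \<in> comp (degree_of d ws)" "w' \<in> comp (degree_of d ws')"
      unfolding w_def w'_def using graded_assignment_var(2)[OF \<phi>] by (auto intro!: wprod_homogeneous)
    have T: "T x \<in> comp (degree_of d ws + g + degree_of d ws')" if "x \<in> comp g" for x
      unfolding T_def using mult_comp[OF mult_comp[OF w(1) that] w(2)] .
    have tval: "tval ?z ?t = btrace g T"
      by (simp add: T_def[abs_def] w_def w'_def)
    show ?thesis
    proof (cases "degree_of d ws + g + degree_of d ws' = g")
      \<comment> \<open>The operator maps degree \<open>g\<close> into another degree, so its block
        trace is zero, in agreement with the zero polynomial in this branch of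
        \<open>trace_mult\<close>.\<close>
      case False
      then have "btrace g T = 0"
        using T by (intro btrace_eq_0[of g T]) auto
      then show ?thesis
        unfolding tval using False by simp
    next
      case True
      have "module_hom (*s) (*s) T"
        unfolding T_def[abs_def] by (rule module_hom_comp[OF module_hom_mult_right module_hom_mult_left])
      moreover have "\<forall>x\<in>comp g. T x \<in> comp g" using T True by simp
      ultimately have tr: "(\<Sum>i | i < n \<and> d i = g. pval (\<phi>(xvar d i := T (\<phi> (xvar d i)))) P) = btrace g T *s pval \<phi> P"
        using TTrace.prems(2) \<phi> unfolding traceable_def by blast
      have "pval \<phi> (psubst (pvar(xvar d i := zword d ws * pvar (xvar d i) * zword d ws')) P) =
        pval (\<phi>(xvar d i := T (\<phi> (xvar d i)))) P" for i
      proof -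
        have "(\<lambda>x. pval \<phi> ((pvar(xvar d i := zword d ws * pvar (xvar d i) * zword d ws')) x)) =
            \<phi>(xvar d i := T (\<phi> (xvar d i)))"
          by (auto simp: fun_eq_iff pval_mult const_free_mult const_free_zword pval_zword T_def w_def w'_def)
        then show ?thesis
          by (subst pval_psubst) (auto simp only: const_free_trace_subst)
      qed
      then have "pval \<phi> ?Q = (\<Sum>i | i < n \<and> d i = g. pval (\<phi>(xvar d i := T (\<phi> (xvar d i)))) P)"
        using True by (simp add: pval_sum)
      then show ?thesis
        unfolding tval by (simp only: tr)
    qed
  qed
  have "traceable ?Q"
    unfolding traceable_def
  proof (intro allI impI)
    fix \<phi> g' T
    assume \<phi>: "graded_assignment comp \<phi>" and T: "module_hom (*s) (*s) T" "\<forall>x\<in>comp g'. T x \<in> comp g'"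
    have "pval (\<phi>(xvar d i := T (\<phi> (xvar d i)))) ?Q =
        tval (\<lambda>i. \<phi> (zvar d i)) ?t *s pval (\<phi>(xvar d i := T (\<phi> (xvar d i)))) P" if "d i = g'" for i
    proof -
      have "graded_assignment comp (\<phi>(xvar d i := T (\<phi> (xvar d i))))"
        using \<phi> T that graded_assignment_var(1)[OF \<phi>, of d i] by (intro graded_assignment_upd) auto
      moreover have "(\<lambda>j. (\<phi>(xvar d i := T (\<phi> (xvar d i)))) (zvar d j)) = (\<lambda>j. \<phi> (zvar d j))"
        by (simp add: fun_eq_iff)
      ultimately show ?thesis
        using main by metis
    qed
    then have "(\<Sum>i | i < n \<and> d i = g'. pval (\<phi>(xvar d i := T (\<phi> (xvar d i)))) ?Q) =
      tval (\<lambda>i. \<phi> (zvar d i)) ?t *s (\<Sum>i | i < n \<and> d i = g'. pval (\<phi>(xvar d i := T (\<phi> (xvar d i)))) P)"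
      unfolding scale_sum_right by (intro sum.cong refl) auto
    also have "\<dots> = btrace g' T *s pval \<phi> ?Q"
      using TTrace.prems(2) \<phi> T unfolding traceable_def main[OF \<phi>] by (simp add: scale_left_commute)
    finally show "(\<Sum>i | i < n \<and> d i = g'. pval (\<phi>(xvar d i := T (\<phi> (xvar d i)))) ?Q) = btrace g' T *s pval \<phi> ?Q" .
  qed
  with main show ?case by blast
qed

section \<open>Polynomial maps and generic homogeneous elements\<close>

definition vpoly :: "'i set \<Rightarrow> (('i \<Rightarrow> 'f) \<Rightarrow> 'a) \<Rightarrow> bool" where
  "vpoly J f \<longleftrightarrow> (\<forall>i<n. polyfun J (\<lambda>t. coord (f t) i))"

lemma vpoly_const: "vpoly J (\<lambda>t. x)"
  by (simp add: vpoly_def polyfun.const)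

lemma vpoly_sum: "(\<And>k. k \<in> K \<Longrightarrow> vpoly J (f k)) \<Longrightarrow> vpoly J (\<lambda>t. \<Sum>k\<in>K. f k t)"
  by (auto simp: vpoly_def coord_sum_distrib intro!: polyfun_sum)

lemma vpoly_scale: "polyfun J p \<Longrightarrow> vpoly J f \<Longrightarrow> vpoly J (\<lambda>t. p t *s f t)"
  by (auto simp: vpoly_def coord_scale intro!: polyfun.mult)

lemma vpoly_mult:
  assumes "vpoly J f" "vpoly J g" shows "vpoly J (\<lambda>t. f t * g t)"
proof -
  have "f t * g t = (\<Sum>i<n. \<Sum>j<n. (coord (f t) i * coord (g t) j) *s (e i * e j))" for t
    by (subst coord_sum[of "f t", symmetric], subst coord_sum[of "g t", symmetric])
      (simp add: sum_product scale_mult_left scale_mult_right mult.commute)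
  then show ?thesis
    using assms by (auto intro!: vpoly_sum vpoly_scale vpoly_const polyfun.mult simp: vpoly_def[of _ f] vpoly_def[of _ g])
qed

lemma vpoly_wprod: "(\<And>k. k \<in> set ks \<Longrightarrow> vpoly J (f k)) \<Longrightarrow> vpoly J (\<lambda>t. wprod (map (\<lambda>k. f k t) ks))"
proof (induction ks)
  case (Cons k ks)
  then show ?case
    by (cases "ks = []") (auto simp: wprod_Cons intro!: vpoly_mult)
qed (simp add: vpoly_const)

lemma polyfun_trace:
  assumes "\<And>i. i \<in> set ws \<union> set ws' \<Longrightarrow> vpoly J (\<lambda>t. z t i)"
  shows "polyfun J (\<lambda>t. tval (z t) (TTrace g ws ws'))"
proof -
  have "vpoly J (\<lambda>t. wprod (map (z t) ws) * e i * wprod (map (z t) ws'))" for i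
    by (intro vpoly_mult vpoly_wprod vpoly_const assms) auto
  then show ?thesis
    by (auto simp: btrace_def vpoly_def intro!: polyfun_sum)
qed

lemma polyfun_tval:
  assumes "\<And>i. vpoly J (\<lambda>t. z t i)" shows "polyfun J (\<lambda>t. tval (z t) \<tau>)"
proof (induction \<tau>)
  case (TTrace g ws ws')
  show ?case by (rule polyfun_trace) (rule assms)
qed (auto intro: polyfun.intros)

lemma vpoly_altsum:
  assumes "\<And>i. i < n \<Longrightarrow> vpoly J (\<lambda>t. z t i)"
  shows "vpoly J (\<lambda>t. altsum n d (\<lambda>k y. u k * y * v k) (z t))"
  unfolding altsum_def
proof (intro vpoly_sum vpoly_scale polyfun.const vpoly_wprod vpoly_mult vpoly_const assms)
  fix p k assume "p \<in> deg_perms n d" "k \<in> set [0..<n]"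
  then show "p k < n"
    using permutes_in_image[OF deg_permsD(1), of p n d k] by simp
qed

text \<open>Each generic element has indeterminate coordinates on the basis vectors of its own
  degree, so every homogeneous tuple is a specialization.\<close>

definition generic :: "(nat \<times> nat \<Rightarrow> 'f) \<Rightarrow> nat \<Rightarrow> 'a" where
  "generic t i = (\<Sum>j | j < n \<and> d j = d i. t (i, j) *s e j)"

lemma generic_homogeneous: "generic t i \<in> comp (d i)"
  unfolding generic_def by (rule comp_sum) (metis (mono_tags) comp_scale e_homogeneous mem_Collect_eq)

lemma vpoly_generic: "(\<And>j. j < n \<Longrightarrow> (i, j) \<in> J) \<Longrightarrow> vpoly J (\<lambda>t. generic t i)"
  unfolding generic_def by (intro vpoly_sum vpoly_scale polyfun.var vpoly_const) auto

lemma generic_coord: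
  assumes "z i \<in> comp (d i)"
  shows "generic (\<lambda>(i, j). coord (z i) j) i = z i"
proof -
  have "(\<Sum>j | j < n \<and> d j = d i. coord (z i) j *s e j) = (\<Sum>j<n. coord (z i) j *s e j)"
    using coord_homogeneous[OF assms] by (intro sum.mono_neutral_left) auto
  then show ?thesis
    by (simp add: generic_def coord_sum)
qed

end

section \<open>Transfer of trace identities\<close>

context assoc_algebra
begin

lemma not_in_graded_identities:
  assumes "p \<notin> graded_identities (*s) V" "const_free p"
  obtains \<phi> where "graded_assignment V \<phi>" "pval \<phi> p \<noteq> 0"
  using assms by (auto simp: graded_identities_def)

lemma in_graded_identities:
  assumes "p \<in> graded_identities (*s) V" "graded_assignment V \<phi>"
  shows "pval \<phi> p = 0"
  using assms by (auto simp: graded_identities_def)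

end

lemma (in nonnull_simple_graded_algebra) capelli_not_identity:
  assumes x: "hom_indep n d x" and n: "n > 0"
  shows "\<exists>h h'. capelli n d h h' \<notin> graded_identities (*s) comp"
proof -
  obtain h h' u v where uv: "\<And>k. u k \<in> comp (h k) \<and> v k \<in> comp (h' k)"
    and nz: "altsum n d (\<lambda>k y. u k * y * v k) x \<noteq> 0"
    using altsum_nonzero_exists[OF x n] by blast
  \<comment> \<open>Division of the index by 4 recovers the position. Alternating variables from
    \<open>n\<close> on get 0, since \<open>x\<close> is known to be homogeneous only below
    \<open>n\<close>.\<close>
  define \<phi> where "\<phi> y = (let i = fst y div 4 in
    if y = xvar d i \<and> i < n then x i else if y = uvar h i then u i else if y = vvar h' i then v i else 0)" for y
  have "graded_assignment comp \<phi>"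
    unfolding graded_assignment_def
  proof (intro allI)
    fix i g
    show "\<phi> (i, g) \<in> comp g"
      using x uv by (auto simp: \<phi>_def Let_def xvar_def uvar_def vvar_def comp_0 hom_indep_def)
  qed
  moreover have "pval \<phi> (capelli n d h h') \<noteq> 0"
  proof -
    have "\<phi> (xvar d i) = x i" if "i < n" for i
      using that by (simp add: \<phi>_def)
    moreover have "\<phi> (uvar h i) = u i" "\<phi> (vvar h' i) = v i" for i
      by (simp_all add: \<phi>_def)
    ultimately have "pval \<phi> (capelli n d h h') = altsum n d (\<lambda>k y. u k * y * v k) x"
      unfolding pval_capelli by (simp add: altsum_cong[of n "\<lambda>i. \<phi> (xvar d i)" x])
    with nz show ?thesis by simp
  qed
  ultimately show ?thesis
    by (auto simp: graded_identities_def)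
qed

lemma (in nonnull_simple_graded_algebra) hom_indep_if_capelli_not_identity:
  assumes "capelli n d h h' \<notin> graded_identities (*s) comp"
  shows "\<exists>x. hom_indep n d x"
proof -
  obtain \<phi> where \<phi>: "graded_assignment comp \<phi>" "pval \<phi> (capelli n d h h') \<noteq> 0"
    using not_in_graded_identities[OF assms const_free_capelli] .
  have "lin_indep {..<n} (\<lambda>i. \<phi> (xvar d i))"
    by (rule lin_indep_if_altsum_nonzero[OF _ _ \<phi>(2)[unfolded pval_capelli]])
      (use module_hom_comp[OF module_hom_mult_right module_hom_mult_left] graded_assignment_var[OF \<phi>(1)] in auto)
  with graded_assignment_var(1)[OF \<phi>(1)] have "hom_indep n d (\<lambda>i. \<phi> (xvar d i))"
    by (simp add: hom_indep_def)
  then show ?thesis by blast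
qed

text \<open>\<open>\<tau>\<close> times a Capelli polynomial is an ordinary graded polynomial and an
  identity of \<open>A\<close>, hence of \<open>B\<close>. Evaluated where the Capelli polynomial is
  nonzero on \<open>B\<close>, its scalar factor must vanish.\<close>

lemma trace_identity_transfer:
  assumes A: "based_graded_algebra sA A n d eA" and B: "based_graded_algebra sB B n d eB"
    and Id: "graded_identities sA A \<subseteq> graded_identities sB B"
    and cap: "capelli n d h h' \<notin> graded_identities sB B"
    and t: "\<And>z. (\<And>i. z i \<in> A (d i)) \<Longrightarrow> based_graded_algebra.tval sA n d eA z \<tau> = 0"
    and z: "\<And>i. z i \<in> B (d i)"
  shows "based_graded_algebra.tval sB n d eB z \<tau> = 0"
proof -
  interpret A: based_graded_algebra sA A n d eA by (rule A)
  interpret B: based_graded_algebra sB B n d eB by (rule B)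
  let ?c = "capelli n d h h'" and ?P = "trace_mult n d \<tau> (capelli n d h h')"
  have "?P \<in> graded_identities sA A"
    unfolding graded_identities_def
  proof (intro CollectI conjI allI impI)
    show "const_free ?P" by (intro const_free_trace_mult const_free_capelli)
    fix \<phi> assume \<phi>: "graded_assignment A \<phi>"
    then show "poly_value sA \<phi> ?P = 0"
      using A.pval_trace_mult[OF const_free_capelli A.traceable_capelli] t graded_assignment_var(2)[OF \<phi>]
      by (metis A.scale_zero_left)
  qed
  with Id have P: "?P \<in> graded_identities sB B" by blast
  obtain \<psi> where \<psi>: "graded_assignment B \<psi>" "poly_value sB \<psi> ?c \<noteq> 0"
    using B.not_in_graded_identities[OF cap const_free_capelli] .
  \<comment> \<open>The Capelli polynomial contains no \<open>z\<close>-variables, so these can be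
    given the prescribed values without changing its value.\<close>
  define \<psi>' where "\<psi>' y = (if y = zvar d (fst y div 4) then z (fst y div 4) else \<psi> y)" for y
  have \<psi>': "\<psi>' (zvar d i) = z i" "\<psi>' (xvar d i) = \<psi> (xvar d i)" "\<psi>' (uvar k i) = \<psi> (uvar k i)"
    "\<psi>' (vvar k i) = \<psi> (vvar k i)" for i k
    by (simp_all add: \<psi>'_def)
  have gr: "graded_assignment B \<psi>'"
    using \<psi>(1) z by (auto simp: graded_assignment_def \<psi>'_def zvar_def)
  have "sB (B.tval (\<lambda>i. \<psi>' (zvar d i)) \<tau>) (poly_value sB \<psi>' ?c) = 0"
    using B.pval_trace_mult[OF const_free_capelli B.traceable_capelli] gr B.in_graded_identities[OF P gr] by metis
  moreover have "poly_value sB \<psi>' ?c = poly_value sB \<psi> ?c"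
    unfolding B.pval_capelli \<psi>' ..
  ultimately show ?thesis
    using \<psi>(2) by (simp add: \<psi>')
qed

lemma graded_isomorphic_if_same_structure_constants:
  assumes A: "based_graded_algebra sA A n d eA" and B: "based_graded_algebra sB B n d eB"
    and eq: "\<And>i j. i < n \<Longrightarrow> j < n \<Longrightarrow> \<exists>c. eA i * eA j = (\<Sum>k<n. sA (c k) (eA k)) \<and> eB i * eB j = (\<Sum>k<n. sB (c k) (eB k))"
  shows "graded_isomorphic sA A sB B"
proof -
  interpret A: based_graded_algebra sA A n d eA by (rule A)
  interpret B: based_graded_algebra sB B n d eB by (rule B)
  define f where "f x = (\<Sum>i<n. sB (A.coord x i) (eB i))" for x
  have coord_f: "B.coord (f x) i = A.coord x i" if "i < n" for x i
    by (rule B.coord_unique) (use that in \<open>auto simp: f_def\<close>)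
  have f_eqI: "f x = y" if "\<And>i. i < n \<Longrightarrow> A.coord x i = B.coord y i" for x y
    by (rule B.eq_if_coord_eq) (simp add: coord_f that)
  have f_add: "f (x + y) = f x + f y" for x y
    by (rule f_eqI) (simp add: A.coord_add B.coord_add coord_f)
  have f_scale: "f (sA c x) = sB c (f x)" for c x
    by (rule f_eqI) (simp add: A.coord_scale B.coord_scale coord_f)
  have hom: "module_hom sA sB f"
    by (simp add: module_hom_iff A.module_axioms B.module_axioms f_add f_scale)
  have f_e: "f (eA i) = eB i" if "i < n" for i
    by (rule f_eqI) (use that in \<open>simp add: A.coord_basis B.coord_basis\<close>)
  have f_ee: "f (eA i * eA j) = eB i * eB j" if "i < n" "j < n" for i j
    using eq[OF that] f_e by (auto simp: module_hom.sum[OF hom] f_scale)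
  have f_mult: "f (x * y) = f x * f y" for x y
  proof -
    have "x * y = (\<Sum>i<n. \<Sum>j<n. sA (A.coord y j) (sA (A.coord x i) (eA i * eA j)))"
      by (subst A.coord_sum[of x, symmetric], subst A.coord_sum[of y, symmetric])
        (simp only: sum_product A.scale_mult_left A.scale_mult_right)
    then have "f (x * y) = (\<Sum>i<n. \<Sum>j<n. sB (A.coord y j) (sB (A.coord x i) (eB i * eB j)))"
      by (simp only: module_hom.sum[OF hom] f_scale) (intro sum.cong refl, simp add: f_ee)
    also have "\<dots> = f x * f y"
      by (simp only: f_def sum_product B.scale_mult_left B.scale_mult_right)
    finally show ?thesis .
  qed
  have bij: "bij f"
  proof (rule bijI)
    show "inj f"
      by (rule injI, rule A.eq_if_coord_eq) (metis coord_f)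
    show "surj f"
    proof (rule surjI)
      fix y
      show "f (\<Sum>i<n. sA (B.coord y i) (eA i)) = y"
        by (rule f_eqI, rule A.coord_unique) auto
    qed
  qed
  have graded: "f ` A g = B g" for g
  proof (intro equalityI subsetI)
    fix y assume "y \<in> f ` A g"
    then obtain x where x: "x \<in> A g" "y = f x" by blast
    have "sB (A.coord x i) (eB i) \<in> B g" if "i < n" for i
      using that B.e_homogeneous[of i] A.coord_homogeneous[OF x(1) that]
      by (cases "d i = g") (auto intro: B.comp_scale simp: B.comp_0)
    then show "y \<in> B g"
      unfolding x(2) f_def by (intro B.comp_sum) auto
  next
    fix y assume y: "y \<in> B g"
    define x where "x = (\<Sum>i<n. sA (B.coord y i) (eA i))"
    have "sA (B.coord y i) (eA i) \<in> A g" if "i < n" for i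
      using that A.e_homogeneous[of i] B.coord_homogeneous[OF y that]
      by (cases "d i = g") (auto intro: A.comp_scale simp: A.comp_0)
    then have "x \<in> A g"
      unfolding x_def by (intro A.comp_sum) auto
    moreover have "f x = y"
      by (rule f_eqI, rule A.coord_unique) (auto simp: x_def)
    ultimately show "y \<in> f ` A g" by blast
  qed
  show ?thesis
    unfolding graded_isomorphic_def graded_isomorphism_def
    using hom f_mult bij graded by (auto simp: module_hom_iff_linear)
qed

text \<open>By bilinearity in the two outer factors it suffices to test on a spanning tuple, so that
  only traces of words in \<open>z\<close> matter below.\<close>

lemma (in based_simple_graded_algebra) btrace_nondegenerate_spanning:
  assumes span: "\<And>x. \<exists>c. x = (\<Sum>i<n. c i *s z i)"
    and r: "\<And>g i j. i < n \<Longrightarrow> j < n \<Longrightarrow> btrace g (\<lambda>x. r * (z i * x * z j)) = 0"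
  shows "r = 0"
proof (rule btrace_nondegenerate)
  fix g h k u v
  obtain b c where bc: "u = (\<Sum>i<n. b i *s z i)" "v = (\<Sum>i<n. c i *s z i)"
    using span by metis
  have "r * (u * x * v) = (\<Sum>i<n. \<Sum>j<n. c j *s (b i *s (r * (z i * x * z j))))" for x
    unfolding bc sum_distrib_right sum_distrib_left
    by (subst sum.swap) (simp only: scale_mult_left scale_mult_right)
  then show "btrace g (\<lambda>x. r * (u * x * v)) = 0"
    by (simp add: btrace_sum btrace_scale r)
qed

lemma realize_traces:
  fixes sA :: "'f::{alg_closed_field, field_char_0} \<Rightarrow> 'a::ring \<Rightarrow> 'a"
    and A :: "'g::group_add \<Rightarrow> 'a set"
    and sB :: "'f \<Rightarrow> 'b::ring \<Rightarrow> 'b" and B :: "'g \<Rightarrow> 'b set"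
  assumes A: "based_simple_graded_algebra sA A n d eA" and B: "based_simple_graded_algebra sB B n d eB"
    and Id: "graded_identities sA A = graded_identities sB B"
    and n: "n > 0"
  obtains z z' where "\<And>i. z i \<in> A (d i)" "\<And>i. z' i \<in> B (d i)" "vector_space.lin_indep sA {..<n} z"
    "\<And>g ws ws'. set ws \<union> set ws' \<subseteq> {..<n} \<Longrightarrow>
      based_graded_algebra.tval sA n d eA z (TTrace g ws ws') = based_graded_algebra.tval sB n d eB z' (TTrace g ws ws')"
proof -
  interpret A: based_simple_graded_algebra sA A n d eA by (rule A)
  interpret B: based_simple_graded_algebra sB B n d eB by (rule B)
  have A_indep: "A.hom_indep n d eA"
    by (simp add: A.hom_indep_def A.e_homogeneous A.e_indep)
  obtain h h' where cap: "capelli n d h h' \<notin> graded_identities sA A"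
    using A.capelli_not_identity[OF A_indep n] by blast
  have A_to_B: "B.tval z' \<tau> = 0"
    if "\<And>z. (\<And>i. z i \<in> A (d i)) \<Longrightarrow> A.tval z \<tau> = 0" "\<And>i. z' i \<in> B (d i)" for \<tau> z'
    using trace_identity_transfer[OF A.based_graded_algebra_axioms B.based_graded_algebra_axioms _ _ that]
      cap Id by auto
  have B_to_A: "A.tval z \<tau> = 0"
    if "\<And>z'. (\<And>i. z' i \<in> B (d i)) \<Longrightarrow> B.tval z' \<tau> = 0" "\<And>i. z i \<in> A (d i)" for \<tau> z
    using trace_identity_transfer[OF B.based_graded_algebra_axioms A.based_graded_algebra_axioms _ _ that]
      cap Id by auto
  define J where "J = {..<n} \<times> {..<n}"
  define X where "X = map (\<lambda>i. Pfun (\<lambda>t :: nat \<times> nat \<Rightarrow> 'f. t i)) (List.product [0..<n] [0..<n])"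
  \<comment> \<open>The function of a trace polynomial on the parameters of homogeneous tuples.
    Indices from \<open>n\<close> on may occur, so it is a function of all variables.
    \<open>R\<close> is the trace ring, and \<open>S\<close> adjoins the coordinate functions
    indexed by \<open>J\<close>.\<close>
  define p where "p \<tau> = Pfun (\<lambda>t. A.tval (A.generic t) \<tau>)" for \<tau>
  have peval_p: "peval (p \<tau>) t = A.tval (A.generic t) \<tau>" for \<tau> t
    unfolding p_def by (subst peval_Pfun[of UNIV]) (auto intro: A.polyfun_tval A.vpoly_generic)
  define R where "R = range p"
  define S where "S = foldl adjoin R X"
  have R: "is_subring R"
    unfolding is_subring_def
  proof (intro conjI ballI)
    have "1 = p (TConst 1)" by (rule pfun_eqI) (simp add: peval_p)
    then show "1 \<in> R" by (auto simp: R_def)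
    fix f assume "f \<in> R"
    then obtain s where s: "f = p s" by (auto simp: R_def)
    have "- f = p (TMult (TConst (- 1)) s)" by (rule pfun_eqI) (simp add: peval_p s)
    then show "- f \<in> R" by (auto simp: R_def)
    fix g assume "g \<in> R"
    then obtain t where t: "g = p t" by (auto simp: R_def)
    have "f + g = p (TAdd s t)" "f * g = p (TMult s t)"
      by (rule pfun_eqI, simp add: peval_p s t)+
    then show "f + g \<in> R" "f * g \<in> R" by (auto simp: R_def)
  qed
  have S: "is_subring S" "R \<subseteq> S" "set X \<subseteq> S"
    unfolding S_def using R is_subring_foldl_adjoin subset_foldl_adjoin set_subset_foldl_adjoin by blast+
  have const: "Pfun (\<lambda>t. c) = p (TConst c)" for c
    by (rule pfun_eqI) (simp add: peval_p peval_Pfun[OF polyfun.const])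
  have S_const: "Pfun (\<lambda>t. c) \<in> S" for c
    using S(2) const by (auto simp: R_def)
  have S_var: "Pfun (\<lambda>t. t i) \<in> S" if "i \<in> J" for i
  proof -
    have "Pfun (\<lambda>t. t i) \<in> set X"
      using that by (auto simp: X_def J_def)
    with S(3) show ?thesis by blast
  qed
  obtain u v where uv: "A.altsum n d (\<lambda>k y. u k * y * v k) eA \<noteq> 0"
    using A.altsum_nonzero_exists[OF A_indep n] by blast
  then obtain k where k: "k < n" "A.coord (A.altsum n d (\<lambda>k y. u k * y * v k) eA) k \<noteq> 0"
    using A.eq_if_coord_eq[of "A.altsum n d (\<lambda>k y. u k * y * v k) eA" 0] by auto
  \<comment> \<open>One coordinate of a Capelli value: where it is nonzero, the tuple is
    independent. It is not the zero function, since it is nonzero at the parameters of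
    \<open>eA\<close>.\<close>
  define w where "w t = A.coord (A.altsum n d (\<lambda>k y. u k * y * v k) (A.generic t)) k" for t
  have w: "polyfun J w"
  proof -
    have "A.vpoly J (\<lambda>t. A.altsum n d (\<lambda>k y. u k * y * v k) (A.generic t))"
      by (intro A.vpoly_altsum A.vpoly_generic) (auto simp: J_def)
    with k show ?thesis by (simp add: A.vpoly_def w_def[abs_def])
  qed
  have "w (\<lambda>(i, j). A.coord (eA i) j) = A.coord (A.altsum n d (\<lambda>k y. u k * y * v k) eA) k"
    unfolding w_def
    by (intro arg_cong[where f = "\<lambda>x. A.coord x k"] A.altsum_cong A.generic_coord A.e_homogeneous)
  then have "Pfun w \<noteq> 0"
    using k peval_Pfun[OF w] by (metis peval_simps(1))
  moreover have "Pfun w \<in> S"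
    by (rule polyfun_mem_subring[OF S(1) S_const S_var w])
  ultimately obtain r where r: "r \<in> R" "r \<noteq> 0" and
    r_ext: "\<And>\<phi> :: _ \<Rightarrow> 'f. hom_on R \<phi> \<Longrightarrow> \<phi> r \<noteq> 0 \<Longrightarrow>
      \<exists>\<chi>. hom_on S \<chi> \<and> (\<forall>c\<in>R. \<chi> c = \<phi> c) \<and> \<chi> (Pfun w) \<noteq> 0"
    using extend_hom[OF R, of "Pfun w" X, where 'f = 'f] unfolding S_def by metis
  obtain \<rho> where \<rho>: "r = p \<rho>" using r by (auto simp: R_def)
  \<comment> \<open>If \<open>\<rho>\<close> vanished on \<open>B\<close>, it would vanish on
    \<open>A\<close> by transfer, and \<open>r\<close> would be zero.\<close>
  have "\<exists>z'. (\<forall>i. z' i \<in> B (d i)) \<and> B.tval z' \<rho> \<noteq> 0"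
  proof (rule ccontr)
    assume "\<not> ?thesis"
    then have "B.tval z' \<rho> = 0" if "\<And>i. z' i \<in> B (d i)" for z'
      using that by blast
    then have "A.tval (A.generic t) \<rho> = 0" for t
      using B_to_A A.generic_homogeneous by blast
    then have "r = 0" by (intro pfun_eqI) (simp add: \<rho> peval_p)
    with r show False by simp
  qed
  then obtain z' where z': "\<And>i. z' i \<in> B (d i)" "B.tval z' \<rho> \<noteq> 0" by blast
  \<comment> \<open>Trace polynomials with the same function on \<open>A\<close> differ by a trace
    identity of \<open>A\<close>, hence of \<open>B\<close>; so evaluation at \<open>z'\<close> is
    well defined on \<open>R\<close>.\<close>
  have wd: "B.tval z' s = B.tval z' t" if "p s = p t" for s t
  proof -
    let ?d = "TAdd s (TMult (TConst (- 1)) t)"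
    have "A.tval z ?d = 0" if z: "\<And>i. z i \<in> A (d i)" for z
    proof -
      have "A.generic (\<lambda>(i, j). A.coord (z i) j) = z"
        by (rule ext, rule A.generic_coord) (rule z)
      then show ?thesis
        using arg_cong[OF \<open>p s = p t\<close>, of "\<lambda>f. peval f (\<lambda>(i, j). A.coord (z i) j)"] by (simp add: peval_p)
    qed
    from A_to_B[OF this z'(1)] show ?thesis by simp
  qed
  define \<phi> where "\<phi> f = B.tval z' (SOME t. f = p t)" for f
  have \<phi>_p: "\<phi> (p t) = B.tval z' t" for t
    unfolding \<phi>_def by (rule wd, rule someI2[of _ t]) auto
  have "hom_on R \<phi>"
    unfolding hom_on_def
  proof (intro conjI ballI)
    have "1 = p (TConst 1)" by (rule pfun_eqI) (simp add: peval_p)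
    then show "\<phi> 1 = 1" using \<phi>_p[of "TConst 1"] by simp
    fix f g assume "f \<in> R" "g \<in> R"
    then obtain s t where st: "f = p s" "g = p t" by (auto simp: R_def)
    have "f + g = p (TAdd s t)" "f * g = p (TMult s t)"
      by (rule pfun_eqI, simp add: peval_p st)+
    then show "\<phi> (f + g) = \<phi> f + \<phi> g" "\<phi> (f * g) = \<phi> f * \<phi> g"
      by (simp_all only: st \<phi>_p B.tval.simps)
  qed
  then obtain \<chi> where \<chi>: "hom_on S \<chi>" "\<And>c. c \<in> R \<Longrightarrow> \<chi> c = \<phi> c" "\<chi> (Pfun w) \<noteq> 0"
    using r_ext[of \<phi>] z'(2) by (auto simp: \<rho> \<phi>_p)
  \<comment> \<open>On functions of the variables in \<open>J\<close>, \<open>\<chi>\<close> is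
    evaluation at this point; the generic tuple specialized there is the required
    \<open>z\<close>.\<close>
  define t0 where "t0 i = \<chi> (Pfun (\<lambda>t. t i))" for i
  have \<chi>_const: "\<chi> (Pfun (\<lambda>t. c)) = c" for c
    using \<chi>(2)[of "p (TConst c)"] by (simp add: const \<phi>_p R_def)
  have \<chi>_eval: "\<chi> (Pfun f) = f t0" if "polyfun J f" for f
    using hom_on_polyfun[OF S(1) S_const S_var \<chi>(1) \<chi>_const that] by (simp add: t0_def[abs_def])
  show thesis
  proof
    show "A.generic t0 i \<in> A (d i)" for i by (rule A.generic_homogeneous)
    show "z' i \<in> B (d i)" for i by (rule z')
    show "A.lin_indep {..<n} (A.generic t0)"
    proof (rule A.lin_indep_if_altsum_nonzero)
      show "A.altsum n d (\<lambda>k y. u k * y * v k) (A.generic t0) \<noteq> 0"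
        using \<chi>(3) k(1) unfolding \<chi>_eval[OF w] w_def by auto
    qed (auto intro: A.generic_homogeneous A.module_hom_comp[OF A.module_hom_mult_right A.module_hom_mult_left])
    fix g ws ws' assume ws: "set ws \<union> set ws' \<subseteq> {..<n}"
    let ?\<tau> = "TTrace g ws ws' :: ('g, 'f) trace_poly"
    \<comment> \<open>Words with indices below \<open>n\<close> involve only variables in
      \<open>J\<close>, so \<open>\<chi>_eval\<close> applies.\<close>
    have "polyfun J (\<lambda>t. A.tval (A.generic t) ?\<tau>)"
      by (intro A.polyfun_trace A.vpoly_generic) (use ws in \<open>auto simp: J_def\<close>)
    from \<chi>_eval[OF this] have "A.tval (A.generic t0) ?\<tau> = \<chi> (p ?\<tau>)"
      by (simp only: p_def)
    also have "\<dots> = B.tval z' ?\<tau>"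
      using \<chi>(2)[of "p ?\<tau>"] \<phi>_p by (simp add: R_def)
    finally show "A.tval (A.generic t0) ?\<tau> = B.tval z' ?\<tau>" .
  qed
qed

section \<open>The isomorphism\<close>

lemma (in nonnull_simple_graded_algebra) based_if_maximal:
  assumes x: "hom_indep n d x" and max: "\<forall>m d' x'. hom_indep m d' x' \<longrightarrow> m \<le> n"
  shows "based_simple_graded_algebra (*s) comp n d x" and "n > 0"
proof -
  have span: "\<exists>c. y = (\<Sum>i<n. c i *s x i)" for y
    by (rule span_if_maximal[OF x]) (use max in blast)
  show "based_simple_graded_algebra (*s) comp n d x"
    by unfold_locales (use x span in \<open>auto simp: hom_indep_def\<close>)
  obtain a b :: 'a where "a * b \<noteq> 0" using nonnull by blast
  with span[of a] show "n > 0" by (cases "n = 0") auto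
qed

lemma (in nonnull_simple_graded_algebra) hom_indep_transfer:
  assumes x: "hom_indep n d x" and n: "n > 0"
    and B: "nonnull_simple_graded_algebra sB B"
    and Id: "graded_identities (*s) comp = graded_identities sB B"
  shows "\<exists>y. graded_algebra.hom_indep sB B n d y"
  using capelli_not_identity[OF x n] nonnull_simple_graded_algebra.hom_indep_if_capelli_not_identity[OF B] Id
  by metis

lemma graded_isomorphic_if_nonnull:
  fixes sA :: "'f::{alg_closed_field, field_char_0} \<Rightarrow> 'a::ring \<Rightarrow> 'a"
    and A :: "'g::group_add \<Rightarrow> 'a set"
    and sB :: "'f \<Rightarrow> 'b::ring \<Rightarrow> 'b" and B :: "'g \<Rightarrow> 'b set"
  assumes A: "nonnull_simple_graded_algebra sA A" and B: "nonnull_simple_graded_algebra sB B"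
    and Id: "graded_identities sA A = graded_identities sB B"
  shows "graded_isomorphic sA A sB B"
proof -
  interpret A: nonnull_simple_graded_algebra sA A by (rule A)
  interpret B: nonnull_simple_graded_algebra sB B by (rule B)
  obtain n d x where x: "A.hom_indep n d x" and x_max: "\<forall>m d' x'. A.hom_indep m d' x' \<longrightarrow> m \<le> n"
    using A.maximal_hom_indep[OF A.fin_dim] by metis
  obtain n' d' y' where y': "B.hom_indep n' d' y'" and y'_max: "\<forall>m d' x'. B.hom_indep m d' x' \<longrightarrow> m \<le> n'"
    using B.maximal_hom_indep[OF B.fin_dim] by metis
  have n: "n > 0" "n' > 0"
    using A.based_if_maximal(2)[OF x x_max] B.based_if_maximal(2)[OF y' y'_max] by blast+
  obtain y where y: "B.hom_indep n d y"
    using A.hom_indep_transfer[OF x n(1) B Id] by blast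
  \<comment> \<open>With the transfer back to \<open>A\<close> the dimensions agree, so
    \<open>y\<close>, which has the degrees of \<open>x\<close>, is maximal in \<open>B\<close> and
    hence a basis.\<close>
  have "n' \<le> n"
    using B.hom_indep_transfer[OF y' n(2) A Id[symmetric]] x_max by blast
  with y y'_max have y_max: "\<forall>m d' x'. B.hom_indep m d' x' \<longrightarrow> m \<le> n"
    using le_trans by blast
  interpret A: based_simple_graded_algebra sA A n d x
    by (rule A.based_if_maximal(1)[OF x x_max])
  interpret B: based_simple_graded_algebra sB B n d y
    by (rule B.based_if_maximal(1)[OF y y_max])
  obtain z z' where z: "\<And>i. z i \<in> A (d i)" and z': "\<And>i. z' i \<in> B (d i)"
    and z_indep: "A.lin_indep {..<n} z"
    and traces: "\<And>g ws ws'. set ws \<union> set ws' \<subseteq> {..<n} \<Longrightarrow> A.tval z (TTrace g ws ws') = B.tval z' (TTrace g ws ws')"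
    using realize_traces[OF A.based_simple_graded_algebra_axioms B.based_simple_graded_algebra_axioms Id n(1)] by metis
  have "A.hom_indep n d z"
    using z z_indep by (simp add: A.hom_indep_def)
  then interpret Az: based_simple_graded_algebra sA A n d z
    by (rule A.based_if_maximal(1)[OF _ x_max])
  \<comment> \<open>Words of three letters test linear combinations of the \<open>z k\<close>, words
    of four letters test the products \<open>z a * z b\<close>.\<close>
  have trace3: "A.btrace g (\<lambda>x. z k * (z i * x * z j)) = B.btrace g (\<lambda>x. z' k * (z' i * x * z' j))"
    if "k < n" "i < n" "j < n" for g i j k
    using traces[of "[k, i]" "[j]" g] that by (simp add: mult.assoc)
  have trace4: "A.btrace g (\<lambda>x. z a * z b * (z i * x * z j)) = B.btrace g (\<lambda>x. z' a * z' b * (z' i * x * z' j))"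
    if "a < n" "b < n" "i < n" "j < n" for g i j a b
    using traces[of "[a, b, i]" "[j]" g] that by (simp add: mult.assoc)
  have btrace_sum_A: "A.btrace g (\<lambda>x. (\<Sum>k<n. sA (c k) (z k)) * (z i * x * z j)) =
      (\<Sum>k<n. c k * A.btrace g (\<lambda>x. z k * (z i * x * z j)))" for c g i j
    by (simp add: sum_distrib_right A.scale_mult_left A.btrace_sum A.btrace_scale)
  have btrace_sum_B: "B.btrace g (\<lambda>x. (\<Sum>k<n. sB (c k) (z' k)) * (z' i * x * z' j)) =
      (\<Sum>k<n. c k * B.btrace g (\<lambda>x. z' k * (z' i * x * z' j)))" for c g i j
    by (simp add: sum_distrib_right B.scale_mult_left B.btrace_sum B.btrace_scale)
  have sums_eq: "A.btrace g (\<lambda>x. (\<Sum>k<n. sA (c k) (z k)) * (z i * x * z j)) =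
      B.btrace g (\<lambda>x. (\<Sum>k<n. sB (c k) (z' k)) * (z' i * x * z' j))" if "i < n" "j < n" for c g i j
    unfolding btrace_sum_A btrace_sum_B by (intro sum.cong refl) (simp add: trace3 that)
  \<comment> \<open>A relation among the \<open>z'\<close> makes all test traces of the same
    combination of the \<open>z\<close> vanish, so that combination is zero by nondegeneracy in
    \<open>A\<close>.\<close>
  have "B.lin_indep {..<n} z'"
    unfolding B.lin_indep_def
  proof (intro allI impI)
    fix c assume c: "(\<Sum>k<n. sB (c k) (z' k)) = 0"
    have "(\<Sum>k<n. sA (c k) (z k)) = 0"
    proof (rule A.btrace_nondegenerate_spanning[OF Az.e_span])
      fix g i j assume "i < n" "j < n"
      from sums_eq[OF this, of g c] show "A.btrace g (\<lambda>x. (\<Sum>k<n. sA (c k) (z k)) * (z i * x * z j)) = 0"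
        by (simp add: c B.btrace_def)
    qed
    then show "\<forall>k\<in>{..<n}. c k = 0"
      using A.lin_indepD[OF z_indep] by blast
  qed
  then have "B.hom_indep n d z'"
    using z' by (simp add: B.hom_indep_def)
  then interpret Bz: based_simple_graded_algebra sB B n d z'
    by (rule B.based_if_maximal(1)[OF _ y_max])
  show ?thesis
  proof (rule graded_isomorphic_if_same_structure_constants)
    show "based_graded_algebra sA A n d z" "based_graded_algebra sB B n d z'" by unfold_locales
    fix a b assume ab: "a < n" "b < n"
    \<comment> \<open>The structure constants of \<open>z\<close>. The same combination of the
      \<open>z'\<close> has the test traces of \<open>z' a * z' b\<close>, so nondegeneracy in
      \<open>B\<close> identifies the two.\<close>
    obtain c where c: "z a * z b = (\<Sum>k<n. sA (c k) (z k))"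
      using Az.e_span by blast
    have "z' a * z' b - (\<Sum>k<n. sB (c k) (z' k)) = 0"
    proof (rule B.btrace_nondegenerate_spanning[OF Bz.e_span])
      fix g i j assume ij: "i < n" "j < n"
      have "B.btrace g (\<lambda>x. z' a * z' b * (z' i * x * z' j)) =
          B.btrace g (\<lambda>x. (\<Sum>k<n. sB (c k) (z' k)) * (z' i * x * z' j))"
        using trace4[OF ab ij, of g] sums_eq[OF ij, of g c] by (simp add: c)
      then show "B.btrace g (\<lambda>x. (z' a * z' b - (\<Sum>k<n. sB (c k) (z' k))) * (z' i * x * z' j)) = 0"
        using B.btrace_add[of g _ "\<lambda>x. sB (- 1) ((\<Sum>k<n. sB (c k) (z' k)) * (z' i * x * z' j))"]
        by (simp add: left_diff_distrib B.btrace_scale[of g "- 1", simplified])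
    qed
    then show "\<exists>c. z a * z b = (\<Sum>k<n. sA (c k) (z k)) \<and> z' a * z' b = (\<Sum>k<n. sB (c k) (z' k))"
      using c by auto
  qed
qed

section \<open>Invariance of identities under isomorphism\<close>

lemma poly_value_hom:
  assumes f: "module_hom sA sB f" "\<And>x y. f (x * y) = f x * f y"
  shows "poly_value sB (\<lambda>x. f (\<phi> x)) p = f (poly_value sA \<phi> p)"
proof -
  have "f (wprod w) = wprod (map f w)" for w
    by (induction w rule: wprod.induct) (auto simp: f module_hom.zero[OF f(1)])
  then show ?thesis
    by (simp add: poly_value_def word_value_eq_wprod module_hom.sum[OF f(1)] module_hom.scale[OF f(1)] o_def)
qed

lemma graded_identities_eq_if_isomorphic:
  assumes "graded_isomorphic sA A sB B"
  shows "graded_identities sA A = graded_identities sB B"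
proof -
  obtain f where f: "module_hom sA sB f" "\<And>x y. f (x * y) = f x * f y" "bij f" "\<And>g. f ` A g = B g"
    using assms by (auto simp: graded_isomorphic_def graded_isomorphism_def module_hom_iff_linear)
  note hom_value = poly_value_hom[OF f(1,2)]
  have inj: "f x = 0 \<longleftrightarrow> x = 0" for x
    using f(3) module_hom.zero[OF f(1)] by (metis bij_pointE)
  have push: "graded_assignment B (\<lambda>x. f (\<phi> x))" if "graded_assignment A \<phi>" for \<phi>
    using that f(4) unfolding graded_assignment_def by (metis imageI)
  have pull: "\<exists>\<phi>. graded_assignment A \<phi> \<and> \<psi> = (\<lambda>x. f (\<phi> x))" if "graded_assignment B \<psi>" for \<psi>
  proof (intro exI conjI)
    show "\<psi> = (\<lambda>x. f (inv f (\<psi> x)))"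
      using f(3) by (simp add: bij_is_surj surj_f_inv_f)
    show "graded_assignment A (\<lambda>x. inv f (\<psi> x))"
      using that f(3,4) unfolding graded_assignment_def by (metis bij_is_inj image_iff inv_f_f)
  qed
  show ?thesis
    unfolding graded_identities_def
  proof (intro Collect_cong conj_cong refl iffI allI impI)
    fix p \<psi> assume "\<forall>\<phi>. graded_assignment A \<phi> \<longrightarrow> poly_value sA \<phi> p = 0" "graded_assignment B \<psi>"
    then show "poly_value sB \<psi> p = 0"
      using pull hom_value inj by metis
  next
    fix p \<phi> assume "\<forall>\<psi>. graded_assignment B \<psi> \<longrightarrow> poly_value sB \<psi> p = 0" "graded_assignment A \<phi>"
    then show "poly_value sA \<phi> p = 0"
      using push hom_value inj by metis
  qed
qed

section \<open>Algebras with zero multiplication\<close>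

context graded_algebra
begin

lemma pvar_identity_iff: "pvar (i, g) \<in> graded_identities (*s) comp \<longleftrightarrow> comp g = {0}"
proof
  assume id: "pvar (i, g) \<in> graded_identities (*s) comp"
  have "x = 0" if "x \<in> comp g" for x
  proof -
    have "graded_assignment comp (\<lambda>y. if snd y = g then x else 0)"
      using that by (simp add: graded_assignment_def comp_0)
    from in_graded_identities[OF id this] show ?thesis by simp
  qed
  then show "comp g = {0}" using comp_0 by blast
qed (auto simp: graded_identities_def graded_assignment_def)

text \<open>Zero multiplication can be tested on homogeneous elements and thus read off the
  identities, so two algebras with the same identities fall into the same case.\<close>

lemma null_iff_identities:
  "(\<forall>x y :: 'a. x * y = 0) \<longleftrightarrow> (\<forall>g h. pvar (0, g) * pvar (1, h) \<in> graded_identities (*s) comp)"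
proof
  assume "\<forall>x y :: 'a. x * y = 0"
  then show "\<forall>g h. pvar (0, g) * pvar (1, h) \<in> graded_identities (*s) comp"
    by (auto simp: graded_identities_def pval_mult const_free_mult)
next
  assume id: "\<forall>g h. pvar (0, g) * pvar (1, h) \<in> graded_identities (*s) comp"
  have *: "x * y = 0" if "x \<in> comp g" "y \<in> comp h" for x y g h
  proof -
    define \<phi> where "\<phi> v = (if v = (0 :: nat, g) then x else if v = (1, h) then y else 0)" for v
    have "graded_assignment comp \<phi>"
      using that by (auto simp: graded_assignment_def \<phi>_def comp_0)
    with id have "pval \<phi> (pvar (0, g) * pvar (1, h)) = 0"
      using in_graded_identities by blast
    then show ?thesis by (simp add: pval_mult \<phi>_def)
  qed
  have "x * y = 0" for x y :: 'a
  proof (rule module_hom_eqI[OF module_hom_mult_left module_hom_0])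
    fix h y assume y: "y \<in> comp h"
    show "x * y = 0"
      by (rule module_hom_eqI[OF module_hom_mult_right module_hom_0]) (rule *[OF _ y])
  qed
  then show "\<forall>x y :: 'a. x * y = 0" by blast
qed

end

text \<open>When all products vanish, the line through a homogeneous element is a homogeneous
  ideal.\<close>

lemma null_simple_one_dimensional:
  fixes scale :: "'f::field \<Rightarrow> 'a::ring \<Rightarrow> 'a" (infixr \<open>*s\<close> 75)
  assumes A: "simple_graded_algebra scale A"
    and null: "\<And>x y :: 'a. x * y = 0" and a: "a \<in> A g" "a \<noteq> 0"
  shows "\<exists>c. x = c *s a"
proof -
  interpret simple_graded_algebra scale A by (rule A)
  let ?I = "range (\<lambda>c. c *s a)"
  have "?I = {0} \<or> ?I = UNIV"
  proof (rule ideal_trivial)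
    show "subspace ?I"
      unfolding subspace_def by (auto simp: image_iff intro: exI[of _ 0] scale_left_distrib[symmetric])
    show "part h y \<in> ?I" if y: "y \<in> ?I" for y h
    proof -
      obtain c where "y = c *s a" using y by blast
      then have "part h y = (if h = g then c else 0) *s a"
        by (simp add: part_scale part_of_homogeneous[OF a(1)])
      then show ?thesis by blast
    qed
  qed (unfold null, (rule range_eqI[of _ _ 0], simp)+)
  moreover have "1 *s a \<in> ?I" by blast
  ultimately show ?thesis using a by auto
qed

lemma graded_isomorphic_if_null:
  fixes sA :: "'f::field_char_0 \<Rightarrow> 'a::ring \<Rightarrow> 'a"
    and A :: "'g::group_add \<Rightarrow> 'a set"
    and sB :: "'f \<Rightarrow> 'b::ring \<Rightarrow> 'b" and B :: "'g \<Rightarrow> 'b set"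
  assumes A: "simple_graded_algebra sA A" and B: "simple_graded_algebra sB B"
    and null: "\<And>x y :: 'a. x * y = 0" "\<And>x y :: 'b. x * y = 0"
    and Id: "graded_identities sA A = graded_identities sB B"
  shows "graded_isomorphic sA A sB B"
proof -
  interpret A: simple_graded_algebra sA A by (rule A)
  interpret B: simple_graded_algebra sB B by (rule B)
  have comp: "A g = {0} \<longleftrightarrow> B g = {0}" for g
    using A.pvar_identity_iff[of 0 g] B.pvar_identity_iff[of 0 g] Id by simp
  have lessThan_1: "{..<1} = {0 :: nat}" by auto
  show ?thesis
  proof (cases "\<forall>g. A g = {0}")
    case True
    then have "x = 0" "y = 0" for x :: 'a and y :: 'b
      using A.sum_part[of x] A.part_in[of _ x] B.sum_part[of y] B.part_in[of _ y] comp by auto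
    then have "based_graded_algebra sA A 0 (\<lambda>_. 0) (\<lambda>_. 0)" "based_graded_algebra sB B 0 (\<lambda>_. 0) (\<lambda>_. 0)"
      by unfold_locales (simp_all add: A.lin_indep_def B.lin_indep_def)
    then show ?thesis
      by (rule graded_isomorphic_if_same_structure_constants) simp
  next
    case False
    \<comment> \<open>The identities show which components vanish, so one degree serves both
      algebras; any nonzero element of it is a basis.\<close>
    then obtain g where "A g \<noteq> {0}" "B g \<noteq> {0}" using comp by blast
    then obtain a b where a: "a \<in> A g" "a \<noteq> 0" and b: "b \<in> B g" "b \<noteq> 0"
      using A.comp_0 B.comp_0 by blast
    have "based_graded_algebra sA A 1 (\<lambda>_. g) (\<lambda>_. a)"
    proof unfold_locales
      show "a \<in> A g" by fact
      show "A.lin_indep {..<1 :: nat} (\<lambda>_. a)"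
        using a by (simp add: A.lin_indep_def lessThan_1)
      fix x
      obtain c where "x = sA c a"
        using null_simple_one_dimensional[OF A null(1) a] by blast
      then show "\<exists>c. x = (\<Sum>i<1 :: nat. sA (c i) a)"
        by (intro exI[of _ "\<lambda>_. c"]) (simp add: lessThan_1)
    qed
    moreover have "based_graded_algebra sB B 1 (\<lambda>_. g) (\<lambda>_. b)"
    proof unfold_locales
      show "b \<in> B g" by fact
      show "B.lin_indep {..<1 :: nat} (\<lambda>_. b)"
        using b by (simp add: B.lin_indep_def lessThan_1)
      fix x
      obtain c where "x = sB c b"
        using null_simple_one_dimensional[OF B null(2) b] by blast
      then show "\<exists>c. x = (\<Sum>i<1 :: nat. sB (c i) b)"
        by (intro exI[of _ "\<lambda>_. c"]) (simp add: lessThan_1)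
    qed
    ultimately show ?thesis
      by (rule graded_isomorphic_if_same_structure_constants) (auto simp: null intro!: exI[of _ "\<lambda>_. 0"])
  qed
qed

theorem mainTheorem1:
  fixes scaleA :: "'f::{alg_closed_field, field_char_0} \<Rightarrow> 'a::ring \<Rightarrow> 'a"
    and A :: "'g::group_add \<Rightarrow> 'a set"
    and scaleB :: "'f \<Rightarrow> 'b::ring \<Rightarrow> 'b"
    and B :: "'g \<Rightarrow> 'b set"
  assumes "simple_graded_algebra scaleA A"
    and "simple_graded_algebra scaleB B"
    and "\<exists>basis. finite_dimensional_vector_space scaleA basis"
    and "\<exists>basis. finite_dimensional_vector_space scaleB basis"
  shows "graded_isomorphic scaleA A scaleB B \<longleftrightarrow>
    graded_identities scaleA A = graded_identities scaleB B"
proof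
  assume "graded_isomorphic scaleA A scaleB B"
  then show "graded_identities scaleA A = graded_identities scaleB B"
    by (rule graded_identities_eq_if_isomorphic)
next
  assume Id: "graded_identities scaleA A = graded_identities scaleB B"
  interpret A: simple_graded_algebra scaleA A by fact
  interpret B: simple_graded_algebra scaleB B by fact
  have null_iff: "(\<forall>x y :: 'a. x * y = 0) \<longleftrightarrow> (\<forall>x y :: 'b. x * y = 0)"
    using A.null_iff_identities B.null_iff_identities Id by simp
  show "graded_isomorphic scaleA A scaleB B"
  proof (cases "\<forall>x y :: 'a. x * y = 0")
    case True
    with null_iff Id assms(1,2) show ?thesis
      by (intro graded_isomorphic_if_null) auto
  next
    case False
    with null_iff have "nonnull_simple_graded_algebra scaleA A" "nonnull_simple_graded_algebra scaleB B"
      using assms by (auto simp: nonnull_simple_graded_algebra_def nonnull_simple_graded_algebra_axioms_def)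
    then show ?thesis
      using Id by (rule graded_isomorphic_if_nonnull)
  qed
qed

end
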